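(* Let $\theta:\mathbb{N}\to\mathbb{R}\cup\{\infty\}$ satisfy $\theta(1)\ge 2$ and $\theta(n)\ge P^+(n)$ for all $n\ge 2$. Let $\mathcal{B}$ be the set of positive integers consisting of $1$ and all $n\ge 2$ with prime factorization $n=p_1^{\alpha_1}\cdots p_k^{\alpha_k}$, $p_1<\cdots<p_k$, such that $p_{j+1}\le \theta(p_1^{\alpha_1}\cdots p_j^{\alpha_j})$ for $0\le j<k$ (the product being $1$ when $j=0$). Let $\chi$ be the characteristic function of $\mathcal{B}$, $B(x)=\#\{n\le x: n\in\mathcal{B}\}$, and $$L=\sum_{n\ge 1}\frac{\chi(n)}{n}\prod_{p\le\theta(n)}\Bigl(1-\frac1p\Bigr).$$ Then $B(x)=(1-L)x+o(x)$ as $x\to\infty$. More precisely, for $x\ge 1$, $$B(x)=(1-L)x+O\left(1+x\sum_{n\ge1}\frac{\chi(n)}{n\log\theta(n)}\exp\left(-\frac{\max(0,\log(x/n))}{3\log\theta(n)}\right)\right).$$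
   Context: $P^+(n)$ denotes the largest prime factor of $n\ge 2$. When $\theta(n)=\infty$, the product over $p\le\theta(n)$ runs over all primes (and equals $0$), and terms with $\log\theta(n)=\infty$ are interpreted as $0$. The series $L$ converges with $0\le L\le 1$. $p$ denotes primes. *)

theory Defs
  imports
    "HOL-Analysis.Analysis"
    "HOL-Library.Landau_Symbols"
    "HOL-Computational_Algebra.Primes"
begin

definition largest_prime_factor :: "nat \<Rightarrow> nat" where
  "largest_prime_factor n = Max (prime_factors n)"

text \<open>
  The value at 0 is irrelevant: the functions of interest live on the positive integers.
  The two conditions exclude the value \<open>-\<infinity>\<close> there, so \<^typ>\<open>ereal\<close> acts as
  the reals extended by \<open>\<infinity>\<close>.
\<close>

definition admissible :: "(nat \<Rightarrow> ereal) \<Rightarrow> bool" where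
  "admissible \<theta> \<longleftrightarrow>
     \<theta> 1 \<ge> 2 \<and> (\<forall>n\<ge>2. \<theta> n \<ge> ereal (real (largest_prime_factor n)))"

text \<open>\<open>prime_seq n ! i\<close> is \<open>p\<^sub>i\<^sub>+\<^sub>1\<close> in the factorization with \<open>p\<^sub>1 < \<dots> < p\<^sub>k\<close>.\<close>

definition prime_seq :: "nat \<Rightarrow> nat list" where
  "prime_seq n = sorted_list_of_set (prime_factors n)"

definition \<B> :: "(nat \<Rightarrow> ereal) \<Rightarrow> nat set" where
  "\<B> \<theta> = {1} \<union> {n. n \<ge> 2 \<and>
     (\<forall>j<length (prime_seq n).
        ereal (real (prime_seq n ! j))
          \<le> \<theta> (\<Prod>i<j. (prime_seq n ! i) ^ multiplicity (prime_seq n ! i) n))}"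

definition char_B :: "(nat \<Rightarrow> ereal) \<Rightarrow> nat \<Rightarrow> real" where
  "char_B \<theta> n = indicator (\<B> \<theta>) n"

definition B :: "(nat \<Rightarrow> ereal) \<Rightarrow> real \<Rightarrow> nat" where
  "B \<theta> x = card {n. real n \<le> x \<and> n \<in> \<B> \<theta>}"

text \<open>
  The case \<open>y = \<infinity>\<close> is the divergent product over all primes, with value 0
  (\<^const>\<open>prod\<close> over an infinite set would give 1).
\<close>

definition prime_prod :: "ereal \<Rightarrow> real" where
  "prime_prod y =
     (if y = \<infinity> then 0 else (\<Prod>p | prime p \<and> ereal (real p) \<le> y. 1 - 1 / real (p::nat)))"

definition L_term :: "(nat \<Rightarrow> ereal) \<Rightarrow> nat \<Rightarrow> real" where
  "L_term \<theta> n = char_B \<theta> n / real n * prime_prod (\<theta> n)"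

definition L :: "(nat \<Rightarrow> ereal) \<Rightarrow> real" where
  "L \<theta> = (\<Sum>\<^sub>\<infinity>n\<in>{1..}. L_term \<theta> n)"

definition error_term :: "(nat \<Rightarrow> ereal) \<Rightarrow> real \<Rightarrow> nat \<Rightarrow> real" where
  "error_term \<theta> x n =
     (if \<theta> n = \<infinity> then 0
      else char_B \<theta> n / (real n * ln (real_of_ereal (\<theta> n))) *
             exp (- (max 0 (ln (x / real n)) / (3 * ln (real_of_ereal (\<theta> n))))))"

end

theory Submission
  imports Defs
begin

text \<open>
  Every positive integer is uniquely \<open>n * r\<close> with \<open>n \<in> \<B>\<close> and all primes of \<open>r\<close> exceeding \<open>\<theta> n\<close>,
  so \<open>\<lfloor>x\<rfloor> = \<Sum>\<^sub>n \<chi>(n) \<Phi>(x/n, \<theta>(n))\<close>, where \<open>\<Phi>(u, y)\<close> counts the integers up to \<open>u\<close> without prime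
  factors \<open>\<le> y\<close>. The cofactors \<open>r = 1\<close> contribute \<open>B(x)\<close>, and the others are counted by the fundamental
  lemma \<open>\<Phi>(u, y) = u \<Prod>\<^sub>p\<^sub>\<le>\<^sub>y (1 - 1/p) + O(u / ln y * exp (- ln u / (3 ln y)))\<close> for \<open>u \<ge> y\<close>; the terms
  with \<open>x/n < \<theta>(n)\<close> have \<open>\<Phi> = 1\<close> and are absorbed by the error sum.

  The fundamental lemma is proved by induction on \<open>y\<close>. If \<open>ln u \<le> K ln y\<close>, the bound
  \<open>\<Phi>(u, y) \<lless> u / ln y\<close> suffices. Otherwise the sieve error \<open>E\<close> satisfies Buchstab's identity
  \<open>E(u, y) = E(u, z) - \<Sum>\<^sub>z\<^sub><\<^sub>p\<^sub>\<le>\<^sub>y E(u/p, p - 1)\<close>, which for \<open>z\<close> about \<open>y\<^sup>1\<^sup>-\<^sup>\<delta>\<close> is a contraction: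
  \<open>E(u, z)\<close> is exponentially smaller than the target, and \<open>\<Sum>\<^sub>z\<^sub><\<^sub>p\<^sub>\<le>\<^sub>y 1/p\<close> is small.
\<close>

section \<open>Chebyshev and Mertens bounds\<close>

lemma prod_primes_dvd:
  fixes n :: nat
  assumes "finite S" "\<And>p. p \<in> S \<Longrightarrow> prime p" "\<And>p. p \<in> S \<Longrightarrow> p dvd n"
  shows "\<Prod>S dvd n"
  using assms
proof (induction S rule: finite_induct)
  case (insert p S)
  have "coprime p (\<Prod>S)"
    using insert by (intro prod_coprime_right primes_coprime) auto
  with insert show ?case by (simp add: divides_mult)
qed simp

text \<open>Such a p divides n! but neither factorial in the denominator, since both of their
  arguments are below p; hence it survives in the quotient.\<close>

lemma prime_dvd_middle_binomial:
  assumes "prime p" "n - n div 2 < p" "p \<le> n"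
  shows "p dvd (n choose (n div 2))"
proof -
  have eq: "fact (n div 2) * fact (n - n div 2) * (n choose (n div 2)) = fact n"
    by (rule binomial_fact_lemma) simp
  have "p dvd fact n"
    using assms by (simp add: prime_dvd_fact_iff)
  moreover have "\<not> p dvd fact (n div 2)" "\<not> p dvd fact (n - n div 2)"
    using assms by (auto simp: prime_dvd_fact_iff)
  ultimately show ?thesis
    using assms(1) eq by (metis prime_dvd_mult_iff)
qed

definition chebyshev_theta :: "nat \<Rightarrow> real" where
  "chebyshev_theta n = (\<Sum>p | prime p \<and> p \<le> n. ln (real p))"

lemma finite_primes_le [simp]: "finite {p. prime p \<and> p \<le> (n::nat)}"
  by (rule finite_subset[of _ "{..n}"]) auto

lemma finite_primes_between [simp]: "finite {p. prime p \<and> m < p \<and> p \<le> (n::nat)}"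
  by (rule finite_subset[of _ "{..n}"]) auto

lemma primes_le_split:
  assumes "z \<le> (y::nat)"
  shows "{p. prime p \<and> p \<le> y} = {p. prime p \<and> p \<le> z} \<union> {p. prime p \<and> z < p \<and> p \<le> y}"
  using assms by auto

text \<open>The product of these primes divides the middle binomial coefficient, which is at most
  2^n. The lower end \<open>n - n div 2\<close> is n/2 rounded up.\<close>

lemma sum_ln_primes_upper_half_le:
  fixes n :: nat
  shows "(\<Sum>p | prime p \<and> n - n div 2 < p \<and> p \<le> n. ln (real p)) \<le> n * ln 2"
proof -
  let ?S = "{p. prime p \<and> n - n div 2 < p \<and> p \<le> n}"
  have pos: "0 < p" if "p \<in> ?S" for p using that by (auto intro: prime_gt_0_nat)
  have "\<Prod>?S dvd (n choose (n div 2))"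
    by (intro prod_primes_dvd) (auto intro: prime_dvd_middle_binomial)
  then have "\<Prod>?S \<le> (n choose (n div 2))"
    by (rule dvd_imp_le) simp
  also have "\<dots> \<le> 2 ^ n" by (rule binomial_le_pow2)
  finally have le: "real (\<Prod>?S) \<le> 2 ^ n"
    by (metis of_nat_le_iff of_nat_numeral of_nat_power)
  have "(\<Sum>p\<in>?S. ln (real p)) = ln (real (\<Prod>?S))"
    using pos by (subst of_nat_prod, subst ln_prod) (auto simp: comp_def)
  also have "\<dots> \<le> ln (2 ^ n)"
    using le pos by (subst ln_le_cancel_iff) (auto intro!: prod_pos)
  finally show ?thesis by (simp add: ln_realpow)
qed

text \<open>Halving argument: with k equal to n/2 rounded up, the primes up to n are those up to k
  and those in (k, n]. The recursion closes because 4(k - 1) + n <= 3n - 2 <= 4(n - 1) for n >=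
  2.\<close>

lemma chebyshev_theta_le_aux:
  "n \<ge> 1 \<Longrightarrow> chebyshev_theta n \<le> 4 * ln 2 * (real n - 1)"
proof (induction n rule: less_induct)
  case (less n)
  show ?case
  proof (cases "n = 1")
    case True
    then have "{p. prime p \<and> p \<le> n} = {}" by (auto dest: prime_ge_2_nat)
    with True show ?thesis unfolding chebyshev_theta_def by (simp only: sum.empty) simp
  next
    case False
    define k where "k = n - n div 2"
    have k: "1 \<le> k" "k < n" using less.prems False by (auto simp: k_def)
    have k': "real k \<le> (real n + 1) / 2" unfolding k_def by (cases "even n") (auto elim!: evenE oddE)
    have "chebyshev_theta n =
        chebyshev_theta k + (\<Sum>p | prime p \<and> k < p \<and> p \<le> n. ln (real p))"
      unfolding chebyshev_theta_def using k
      by (subst primes_le_split[of k]) (auto intro!: sum.union_disjoint)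
    also have "\<dots> \<le> 4 * ln 2 * (real k - 1) + n * ln 2"
      using less.IH[OF k(2,1)] sum_ln_primes_upper_half_le[of n] by (simp add: k_def)
    also have "\<dots> = (4 * (real k - 1) + n) * ln 2" by (simp add: algebra_simps)
    also have "\<dots> \<le> (4 * (real n - 1)) * ln 2"
      using k' False less.prems by (intro mult_right_mono) auto
    finally show ?thesis by (simp add: algebra_simps)
  qed
qed

lemma chebyshev_theta_le: "chebyshev_theta n \<le> 4 * ln 2 * real n"
proof (cases "n = 0")
  case True
  then have "{p. prime p \<and> p \<le> n} = {}" by (auto dest: prime_ge_2_nat)
  with True show ?thesis by (simp add: chebyshev_theta_def)
next
  case False
  then have "chebyshev_theta n \<le> 4 * ln 2 * (real n - 1)"
    by (intro chebyshev_theta_le_aux) simp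
  also have "\<dots> \<le> 4 * ln 2 * real n" by (intro mult_left_mono) auto
  finally show ?thesis .
qed

text \<open>Dyadic blocks: by Chebyshev's bound the primes in (w, 2w] contribute at most 8 ln 2,
  which is exactly what 8 ln (y/w) loses when w is doubled. The summand 1 pays for the last,
  possibly incomplete block, as ln 2 < 1.\<close>

lemma sum_ln_over_primes_le:
  fixes w y :: nat
  assumes "1 \<le> w" "w \<le> y"
  shows "(\<Sum>p | prime p \<and> w < p \<and> p \<le> y. ln (real p) / p) \<le> 8 * (ln (y / w) + 1)"
  using assms
proof (induction "y - w" arbitrary: w rule: less_induct)
  case less
  have short: "(\<Sum>p | prime p \<and> w < p \<and> p \<le> v. ln (real p) / p) \<le> 8 * ln 2"
    if "v \<le> 2 * w" for v
  proof -
    have "(\<Sum>p | prime p \<and> w < p \<and> p \<le> v. ln (real p) / p) \<le>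
        (\<Sum>p | prime p \<and> w < p \<and> p \<le> v. ln (real p) / w)"
      using less.prems by (intro sum_mono divide_left_mono) (auto dest: prime_gt_0_nat simp: Suc_le_eq)
    also have "\<dots> = (\<Sum>p | prime p \<and> w < p \<and> p \<le> v. ln (real p)) / w"
      by (simp add: sum_divide_distrib)
    also have "\<dots> \<le> chebyshev_theta v / w"
      unfolding chebyshev_theta_def
      by (intro divide_right_mono sum_mono2) (auto dest: prime_gt_0_nat simp: Suc_le_eq)
    also have "\<dots> \<le> 4 * ln 2 * real v / w"
      by (intro divide_right_mono chebyshev_theta_le) simp
    also have "\<dots> \<le> 4 * ln 2 * (2 * real w) / w"
      using that by (intro divide_right_mono mult_left_mono) auto
    also have "\<dots> = 8 * ln 2" using less.prems by simp
    finally show ?thesis .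
  qed
  show ?case
  proof (cases "y \<le> 2 * w")
    case True
    have "ln 2 \<le> (1::real)" using ln_2_less_1 by simp
    moreover have "ln (y / w) \<ge> 0" using less.prems by simp
    ultimately show ?thesis using short[OF True] by simp
  next
    case False
    have split: "{p. prime p \<and> w < p \<and> p \<le> y} =
        {p. prime p \<and> w < p \<and> p \<le> 2 * w} \<union> {p. prime p \<and> 2 * w < p \<and> p \<le> y}"
      using False by auto
    have "(\<Sum>p | prime p \<and> w < p \<and> p \<le> y. ln (real p) / p) =
        (\<Sum>p | prime p \<and> w < p \<and> p \<le> 2 * w. ln (real p) / p) +
        (\<Sum>p | prime p \<and> 2 * w < p \<and> p \<le> y. ln (real p) / p)"
      unfolding split by (intro sum.union_disjoint) auto
    also have "\<dots> \<le> 8 * ln 2 + 8 * (ln (y / real (2 * w)) + 1)"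
      using False less.prems by (intro add_mono short less.hyps) auto
    also have "\<dots> = 8 * (ln (y / w) + 1)"
      using less.prems by (simp add: ln_div ln_mult)
    finally show ?thesis .
  qed
qed

text \<open>Each ln p is at least ln w. For large y the bound is O(1) when w is a fixed power of y,
  and small when the exponent of that power is close to 1; both regimes occur in the sieve.\<close>

lemma sum_inverse_primes_le:
  fixes w y :: nat
  assumes "2 \<le> w" "w \<le> y"
  shows "(\<Sum>p | prime p \<and> w < p \<and> p \<le> y. 1 / real p) \<le> 8 * (ln (y / w) + 1) / ln w"
proof -
  have "(\<Sum>p | prime p \<and> w < p \<and> p \<le> y. 1 / real p) \<le>
      (\<Sum>p | prime p \<and> w < p \<and> p \<le> y. ln (real p) / p / ln w)"
  proof (intro sum_mono)
    fix p assume "p \<in> {p. prime p \<and> w < p \<and> p \<le> y}"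
    then have "ln (real w) \<le> ln (real p)" "0 < ln (real w)" "0 < real p" using assms by auto
    then show "1 / real p \<le> ln (real p) / p / ln w" by (simp add: field_simps)
  qed
  also have "\<dots> = (\<Sum>p | prime p \<and> w < p \<and> p \<le> y. ln (real p) / p) / ln w"
    by (simp add: sum_divide_distrib)
  also have "\<dots> \<le> 8 * (ln (y / w) + 1) / ln w"
    using assms by (intro divide_right_mono sum_ln_over_primes_le) auto
  finally show ?thesis .
qed

section \<open>Upper and lower bounds for Mertens' product\<close>

definition mertens_prod :: "nat \<Rightarrow> real" where
  "mertens_prod y = (\<Prod>p | prime p \<and> p \<le> y. 1 - 1 / real p)"

text \<open>Splitting off the full power of one prime writes m uniquely as p^a k with k free of p,
  so the sum is at most a geometric series times the sum over the cofactors k. Letting M be any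
  finite set of integers composed of primes in S keeps all sums finite.\<close>

lemma sum_inverse_le_euler_prod:
  assumes "finite S" "\<And>p. p \<in> S \<Longrightarrow> prime p" "finite M"
    "\<And>m. m \<in> M \<Longrightarrow> 0 < m \<and> prime_factors m \<subseteq> S"
  shows "(\<Sum>m\<in>M. 1 / real m) \<le> (\<Prod>p\<in>S. 1 / (1 - 1 / real p))"
  using assms
proof (induction S arbitrary: M rule: finite_induct)
  case empty
  have "M \<subseteq> {1}"
  proof
    fix m assume "m \<in> M"
    then have "0 < m" "prime_factors m = {}" using empty by auto
    then show "m \<in> {1}" by (auto simp: prime_factorization_empty_iff)
  qed
  then have "(\<Sum>m\<in>M. 1 / real m) \<le> (\<Sum>m\<in>{1}. 1 / real m)" by (intro sum_mono2) auto
  then show ?case by simp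
next
  case (insert p S)
  have p: "prime p" "1 < p" using insert.prems(1)[of p] prime_gt_1_nat by auto
  define f where "f m = (multiplicity p m, m div p ^ multiplicity p m)" for m
  define N where "N = Max (insert 0 (multiplicity p ` M))"
  define M' where "M' = (\<lambda>m. m div p ^ multiplicity p m) ` M"
  have fin: "finite M'" using insert.prems by (simp add: M'_def)
  have mult: "m = p ^ fst (f m) * snd (f m)" for m
    by (simp add: f_def multiplicity_dvd)
  have inj: "inj_on f M" by (metis inj_onI mult)
  have img: "f ` M \<subseteq> {..N} \<times> M'"
    using insert.prems by (auto simp: f_def N_def M'_def)
  have M': "0 < k \<and> prime_factors k \<subseteq> S" if "k \<in> M'" for k
  proof -
    from that obtain m where m: "m \<in> M" "k = m div p ^ multiplicity p m" by (auto simp: M'_def)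
    have m0: "0 < m" "prime_factors m \<subseteq> insert p S" using insert.prems m by auto
    have mk: "m = p ^ multiplicity p m * k" using m by (simp add: multiplicity_dvd)
    then have k0: "0 < k" using m0 by (metis gr0I mult_0_right)
    have "\<not> p dvd k"
      using multiplicity_decompose[of m p] m m0 p by auto
    moreover have "prime_factors k \<subseteq> prime_factors m"
      using mk m0 by (intro dvd_prime_factors) (auto intro: dvdI[of _ _ "p ^ multiplicity p m"] simp: mult.commute)
    ultimately show ?thesis using m0 k0 by (auto simp: prime_factors_dvd)
  qed
  have "(\<Sum>m\<in>M. 1 / real m) = (\<Sum>m\<in>M. 1 / (real p ^ fst (f m) * real (snd (f m))))"
    by (metis mult of_nat_mult of_nat_power)
  also have "\<dots> = (\<Sum>x\<in>f ` M. 1 / (real p ^ fst x * real (snd x)))"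
    using inj by (simp add: sum.reindex)
  also have "\<dots> \<le> (\<Sum>x\<in>{..N} \<times> M'. 1 / (real p ^ fst x * real (snd x)))"
    using img fin by (intro sum_mono2) auto
  also have "\<dots> = (\<Sum>a\<in>{..N}. \<Sum>k\<in>M'. (1 / real p) ^ a * (1 / real k))"
    by (simp add: sum.cartesian_product case_prod_beta power_divide)
  also have "\<dots> = (\<Sum>a\<in>{..N}. (1 / real p) ^ a) * (\<Sum>k\<in>M'. 1 / real k)"
    by (simp add: sum_product)
  also have "\<dots> \<le> 1 / (1 - 1 / real p) * (\<Prod>p\<in>S. 1 / (1 - 1 / real p))"
  proof (intro mult_mono)
    have "(\<Sum>a\<in>{..N}. (1 / real p) ^ a) = (1 - (1 / real p) ^ Suc N) / (1 - 1 / real p)"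
      using p by (subst sum_gp_basic[symmetric, THEN arg_cong[where f = "\<lambda>t. t / (1 - 1 / real p)"]]) auto
    also have "\<dots> \<le> 1 / (1 - 1 / real p)"
      using p by (intro divide_right_mono) auto
    finally show "(\<Sum>a\<in>{..N}. (1 / real p) ^ a) \<le> 1 / (1 - 1 / real p)" .
    show "(\<Sum>k\<in>M'. 1 / real k) \<le> (\<Prod>p\<in>S. 1 / (1 - 1 / real p))"
      using insert.prems fin M' by (intro insert.IH) auto
  qed (use p in \<open>auto intro!: sum_nonneg\<close>)
  finally show ?case using insert.hyps by simp
qed

lemma one_minus_inverse_prime_pos: "prime (p::nat) \<Longrightarrow> 0 < 1 - 1 / real p"
  using prime_gt_1_nat[of p] by simp

lemma mertens_prod_pos: "0 < mertens_prod y"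
  unfolding mertens_prod_def by (intro prod_pos one_minus_inverse_prime_pos) auto

text \<open>All m <= y are composed of primes up to y, so the Euler product dominates the harmonic
  sum.\<close>

lemma mertens_prod_le:
  assumes "2 \<le> y"
  shows "mertens_prod y \<le> 1 / ln (real y)"
proof -
  have "ln (real y) \<le> ln (real y + 1)" using assms by simp
  also have "\<dots> \<le> harm y" by (rule ln_le_harm)
  also have "\<dots> = (\<Sum>m\<in>{1..y}. 1 / real m)" by (simp add: harm_def inverse_eq_divide)
  also have "\<dots> \<le> (\<Prod>p | prime p \<and> p \<le> y. 1 / (1 - 1 / real p))"
    by (intro sum_inverse_le_euler_prod) (auto simp: prime_factors_dvd intro: order_trans[OF dvd_imp_le])
  also have "\<dots> = 1 / mertens_prod y"
    by (simp add: mertens_prod_def prod_dividef)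
  finally show ?thesis using mertens_prod_pos[of y] assms by (simp add: field_simps)
qed

text \<open>A bound for partial sums of zeta(1 + s). From 1 + s/n <= (1 - 1/n)^(-s) one gets
  n^(-1-s) <= ((n-1)^(-s) - n^(-s)) / s for n >= 2, and the right side telescopes.\<close>

lemma sum_powr_le:
  assumes "0 < s"
  shows "(\<Sum>n=1..N. real n powr (-1 - s)) \<le> 1 + 1 / s"
proof -
  have "(\<Sum>n=1..Suc N. real n powr (-1 - s)) \<le> 1 + (1 - real (Suc N) powr (-s)) / s" for N
  proof (induction N)
    case (Suc N)
    define n where "n = real (Suc (Suc N))"
    have n: "n > 1" by (simp add: n_def)
    have "ln (1 - 1 / n) \<le> - (1 / n)"
      using ln_add_one_self_le_self2[of "- (1 / n)"] n by simp
    then have "s * ln (1 - 1 / n) \<le> s * - (1 / n)" using assms by (intro mult_left_mono) auto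
    then have "1 + s / n \<le> 1 - s * ln (1 - 1 / n)" by simp
    also have "\<dots> \<le> exp (- s * ln (1 - 1 / n))"
      using exp_ge_add_one_self[of "- s * ln (1 - 1 / n)"] by simp
    also have "\<dots> = (1 - 1 / n) powr (-s)" using n by (simp add: powr_def)
    finally have "n powr (-s) * (1 + s / n) \<le> n powr (-s) * (1 - 1 / n) powr (-s)"
      by (intro mult_left_mono) auto
    also have "\<dots> = (n * (1 - 1 / n)) powr (-s)"
      using n by (subst powr_mult) auto
    also have "n * (1 - 1 / n) = real (Suc N)" using n by (simp add: n_def field_simps)
    finally have "n powr (-1 - s) \<le> (real (Suc N) powr (-s) - n powr (-s)) / s"
      using assms n by (simp add: field_simps powr_diff powr_minus powr_add)
    moreover have "(\<Sum>n=1..Suc (Suc N). real n powr (-1 - s)) =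
        (\<Sum>n=1..Suc N. real n powr (-1 - s)) + n powr (-1 - s)"
      by (simp add: n_def)
    ultimately show ?case using Suc unfolding n_def[symmetric] by (simp add: diff_divide_distrib)
  qed simp
  moreover have "(\<Sum>n=1..N. real n powr (-1 - s)) \<le> (\<Sum>n=1..Suc N. real n powr (-1 - s))" by simp
  moreover have "1 + (1 - real (Suc N) powr (-s)) / s \<le> 1 + 1 / s"
    using assms by (simp add: divide_right_mono)
  ultimately show ?thesis by (meson order_trans)
qed

text \<open>Expanding the product gives a sum over the subsets A of S. Their products are distinct
  integers, so the sum is part of the series for zeta(1 + s).\<close>

lemma prod_one_plus_powr_primes_le:
  assumes "finite S" "\<And>p. p \<in> S \<Longrightarrow> prime (p::nat)" "0 < s"
  shows "(\<Prod>p\<in>S. 1 + real p powr (-1 - s)) \<le> 1 + 1 / s"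
proof -
  have inj: "inj_on (\<lambda>A. \<Prod>A) (Pow S)"
  proof (rule inj_onI)
    fix A A' assume A: "A \<in> Pow S" "A' \<in> Pow S" and eq: "\<Prod>A = \<Prod>A'"
    \<comment> \<open>A set of primes is recovered from its product, which makes the expansion
      injective.\<close>
    have "prime_factors (\<Prod>X) = X" if "X \<subseteq> S" for X
    proof -
      have X: "finite X" "\<And>p. p \<in> X \<Longrightarrow> prime p" using that assms finite_subset by blast+
      have "p \<in> prime_factors (\<Prod>X) \<longleftrightarrow> p \<in> X" for p
      proof -
        have "p \<in> prime_factors (\<Prod>X) \<longleftrightarrow> prime p \<and> p dvd \<Prod>X"
          using X by (subst prime_factors_dvd) (auto dest: prime_gt_0_nat)
        also have "\<dots> \<longleftrightarrow> prime p \<and> (\<exists>q\<in>X. p dvd q)"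
          using X(1) by (auto simp: prime_dvd_prod_iff)
        also have "\<dots> \<longleftrightarrow> p \<in> X" using X(2) by (metis dvd_refl primes_dvd_imp_eq)
        finally show ?thesis .
      qed
      then show ?thesis by blast
    qed
    then show "A = A'" using A eq by (metis PowD)
  qed
  define T where "T = (\<lambda>A. \<Prod>A) ` Pow S"
  have T: "finite T" "T \<subseteq> {1..Max T}"
  proof -
    show T: "finite T" using assms by (simp add: T_def)
    have "0 < n" if "n \<in> T" for n
    proof -
      from that obtain A where A: "A \<subseteq> S" "n = \<Prod>A" by (auto simp: T_def)
      have "0 < p" if "p \<in> A" for p using that A assms(2)[of p] by (auto intro: prime_gt_0_nat)
      then show ?thesis unfolding A(2) by (rule prod_pos)
    qed
    then show "T \<subseteq> {1..Max T}" using T by (auto simp: Suc_le_eq)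
  qed
  have "(\<Prod>p\<in>S. 1 + real p powr (-1 - s)) = (\<Sum>A\<in>Pow S. \<Prod>p\<in>A. real p powr (-1 - s))"
    using assms by (subst add.commute, subst prod_add) auto
  also have "\<dots> = (\<Sum>A\<in>Pow S. real (\<Prod>A) powr (-1 - s))"
    by (intro sum.cong refl) (auto simp: prod_powr_distrib)
  also have "\<dots> = (\<Sum>n\<in>T. real n powr (-1 - s))"
    unfolding T_def by (subst sum.reindex[OF inj]) simp
  also have "\<dots> \<le> (\<Sum>n=1..Max T. real n powr (-1 - s))"
    using T by (intro sum_mono2) auto
  also have "\<dots> \<le> 1 + 1 / s" using assms by (intro sum_powr_le)
  finally show ?thesis .
qed

text \<open>The product over all n from 2 to M telescopes to (M + 1) / (2M) > 1/2, and dropping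
  factors in [0, 1] cannot decrease it.\<close>

lemma prod_one_minus_inverse_square_ge:
  assumes "finite S" "\<And>n. n \<in> S \<Longrightarrow> 2 \<le> n"
  shows "1 / 2 \<le> (\<Prod>n\<in>S. 1 - 1 / real n ^ 2)"
proof -
  have tele: "(\<Prod>n=2..Suc (Suc N). 1 - 1 / real n ^ 2) = (real N + 3) / (2 * (real N + 2))" for N
  proof (induction N)
    case 0
    then show ?case by (simp add: numeral_2_eq_2 power2_eq_square)
  next
    case (Suc N)
    have "(\<Prod>n=2..Suc (Suc (Suc N)). 1 - 1 / real n ^ 2) =
        (real N + 3) / (2 * (real N + 2)) * (1 - 1 / (real N + 3) ^ 2)"
      using Suc by (simp add: add.commute)
    also have "\<dots> = (real (Suc N) + 3) / (2 * (real (Suc N) + 2))"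
      by (simp add: divide_simps) (simp add: power2_eq_square algebra_simps)
    finally show ?case .
  qed
  define N where "N = Max (insert 2 S)"
  have "1 / 2 \<le> (\<Prod>n=2..Suc (Suc N). 1 - 1 / real n ^ 2)"
    unfolding tele by (simp add: field_simps)
  also have "\<dots> = (\<Prod>n\<in>S. 1 - 1 / real n ^ 2) * (\<Prod>n\<in>{2..Suc (Suc N)} - S. 1 - 1 / real n ^ 2)"
    using assms by (subst mult.commute, intro prod.subset_diff) (auto simp: N_def le_SucI)
  also have "\<dots> \<le> (\<Prod>n\<in>S. 1 - 1 / real n ^ 2)"
  proof (rule mult_right_le_one_le)
    have *: "0 \<le> 1 - 1 / real n ^ 2" if "2 \<le> n" for n :: nat using that by simp
    show "0 \<le> (\<Prod>n\<in>S. 1 - 1 / real n ^ 2)" using assms * by (intro prod_nonneg) blast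
    show "0 \<le> (\<Prod>n\<in>{2..Suc (Suc N)} - S. 1 - 1 / real n ^ 2)" using * by (intro prod_nonneg) auto
    show "(\<Prod>n\<in>{2..Suc (Suc N)} - S. 1 - 1 / real n ^ 2) \<le> 1"
      using * by (intro prod_le_1) auto
  qed
  finally show ?thesis .
qed

lemma ln_ge_half: "2 \<le> y \<Longrightarrow> 1 / 2 \<le> ln (y::real)"
  using ln_mono[of 2 y] ln2_ge_two_thirds by linarith

text \<open>The factors of 1 / \<open>mertens_prod y\<close> are (1 + 1/p) / (1 - 1/p^2), and the
  denominators multiply to at least 1/2. Replacing 1/p by p^(-1-s) with s = 1 / ln y costs a factor
  exp (s \<Sum> ln p / p) = O(1), and the resulting product is at most 1 + 1/s, of order ln
  y.\<close>

lemma mertens_prod_ge: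
  obtains c where "0 < c" "\<And>y. 2 \<le> y \<Longrightarrow> c / ln (real y) \<le> mertens_prod y"
proof
  \<comment> \<open>The 6 is 2 from the squares times 3 from 1 + ln y <= 3 ln y; the 24 bounds 8 +
    8s, since s <= 2.\<close>
  show "0 < 1 / (6 * exp 24 :: real)" by simp
  fix y :: nat assume y: "2 \<le> y"
  let ?S = "{p. prime p \<and> p \<le> y}"
  define s where "s = 1 / ln (real y)"
  have ly: "1 / 2 \<le> ln (real y)" using y by (intro ln_ge_half) simp
  then have s: "0 < s" by (simp add: s_def)
  have factor: "1 / (1 - 1 / real p) =
      (1 + 1 / real p) / (1 - 1 / real p ^ 2)" if "p \<in> ?S" for p
  proof -
    have "1 - 1 / real p ^ 2 = (1 - 1 / real p) * (1 + 1 / real p)"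
      by (simp add: algebra_simps power2_eq_square)
    then show ?thesis using that by (simp add: add_pos_nonneg less_imp_neq[symmetric])
  qed
  \<comment> \<open>For a = 1/p and b = p^(-1-s) <= a one has 1 + a <= (1 + b)(1 + (a - b)), and a -
    b = a (1 - exp (-s ln p)) <= s ln p / p.\<close>
  have step: "1 + 1 / real p \<le> (1 + real p powr (-1 - s)) * exp (s * (ln (real p) / p))"
    if "p \<in> ?S" for p
  proof -
    have p: "0 < real p" using that by (auto dest: prime_gt_0_nat)
    define a b where "a = 1 / real p" and "b = real p powr (-1 - s)"
    have b: "b = a * exp (- (s * ln p))" using p by (simp add: a_def b_def powr_def exp_diff exp_minus field_simps)
    have a0: "0 < a" "0 \<le> b" using p by (auto simp: a_def b_def)
    have "1 - s * ln p \<le> exp (- (s * ln p))" using exp_ge_add_one_self[of "- (s * ln p)"] by simp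
    then have "a * (1 - s * ln p) \<le> b" unfolding b using a0 by (intro mult_left_mono) auto
    then have ab: "a - b \<le> s * (ln p / p)" by (simp add: a_def algebra_simps)
    have "s * ln p \<ge> 0" using s that by (auto dest: prime_gt_0_nat simp: Suc_le_eq)
    then have "b \<le> a" unfolding b using a0 by simp
    then have "0 \<le> b * (a - b)" using a0 by simp
    then have "1 + a \<le> (1 + b) * (1 + (a - b))" by (simp add: algebra_simps)
    also have "\<dots> \<le> (1 + b) * exp (s * (ln p / p))"
      using ab a0 exp_ge_add_one_self[of "s * (ln p / p)"] by (intro mult_left_mono) linarith+
    finally show ?thesis by (simp add: a_def b_def)
  qed
  have primes: "?S = {p. prime p \<and> 1 < p \<and> p \<le> y}" by (auto dest: prime_gt_1_nat)
  have "s * (\<Sum>p\<in>?S. ln (real p) / p) \<le> s * (8 * (ln (real y / real 1) + 1))"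
    unfolding primes using y s by (intro mult_left_mono sum_ln_over_primes_le) auto
  also have "\<dots> = 8 + 8 * s" using ly by (simp add: s_def field_simps)
  also have "\<dots> \<le> 24" using ly by (simp add: s_def field_simps)
  finally have s24: "s * (\<Sum>p\<in>?S. ln (real p) / p) \<le> 24" .
  have "1 / mertens_prod y = (\<Prod>p\<in>?S. 1 / (1 - 1 / real p))"
    by (simp add: mertens_prod_def prod_dividef)
  also have "\<dots> = (\<Prod>p\<in>?S. 1 + 1 / real p) / (\<Prod>p\<in>?S. 1 - 1 / real p ^ 2)"
    unfolding prod_dividef[symmetric] by (intro prod.cong refl factor)
  also have "\<dots> \<le> (\<Prod>p\<in>?S. 1 + 1 / real p) / (1 / 2)"
  proof (intro divide_left_mono)
    show sq: "1 / 2 \<le> (\<Prod>p\<in>?S. 1 - 1 / real p ^ 2)"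
      by (intro prod_one_minus_inverse_square_ge) (auto dest: prime_ge_2_nat)
    show "0 < (\<Prod>p\<in>?S. 1 - 1 / real p ^ 2) * (1 / 2)" using sq by linarith
  qed (auto intro: prod_nonneg)
  also have "(\<Prod>p\<in>?S. 1 + 1 / real p) \<le>
      (\<Prod>p\<in>?S. (1 + real p powr (-1 - s)) * exp (s * (ln (real p) / p)))"
    using step by (intro prod_mono) auto
  also have "\<dots> = (\<Prod>p\<in>?S. 1 + real p powr (-1 - s)) * exp (s * (\<Sum>p\<in>?S. ln (real p) / p))"
    by (simp add: prod.distrib exp_sum sum_distrib_left)
  also have "\<dots> \<le> (1 + 1 / s) * exp 24"
    using s s24 by (intro mult_mono prod_one_plus_powr_primes_le) auto
  also have "1 + 1 / s \<le> 3 * ln (real y)" using ly by (simp add: s_def)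
  finally have "1 / mertens_prod y \<le> 6 * exp 24 * ln (real y)" by (simp add: divide_right_mono mult_ac)
  then show "1 / (6 * exp 24) / ln (real y) \<le> mertens_prod y"
    using mertens_prod_pos[of y] ly by (simp add: field_simps)
qed

section \<open>Sieving by the primes up to a bound\<close>

definition rough_set :: "real \<Rightarrow> nat \<Rightarrow> nat set" where
  "rough_set u y = {m. 0 < m \<and> real m \<le> u \<and> (\<forall>p. prime p \<longrightarrow> p dvd m \<longrightarrow> y < p)}"

definition rough_error :: "real \<Rightarrow> nat \<Rightarrow> real" where
  "rough_error u y = real (card (rough_set u y)) - u * mertens_prod y"

lemma finite_rough_set [simp]: "finite (rough_set u y)"
proof (rule finite_subset)
  show "rough_set u y \<subseteq> {..nat \<lfloor>u\<rfloor>}" by (auto simp: rough_set_def le_nat_floor)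
qed simp

lemma rough_error_0:
  assumes "0 \<le> u"
  shows "\<bar>rough_error u 0\<bar> \<le> 1"
proof -
  have "rough_set u 0 = {1..nat \<lfloor>u\<rfloor>}"
    using assms by (auto simp: rough_set_def le_nat_floor dest: prime_gt_0_nat) linarith
  moreover have "{p. prime p \<and> p \<le> (0::nat)} = {}" by (auto dest: prime_gt_0_nat)
  then have "mertens_prod 0 = 1" unfolding mertens_prod_def by (simp only: prod.empty)
  ultimately have "rough_error u 0 = real (nat \<lfloor>u\<rfloor>) - u" by (simp add: rough_error_def)
  then show ?thesis using assms by linarith
qed

text \<open>Integers surviving up to y are split by divisibility by the next prime. The cofactor k
  is again sieved only up to y, because \<open>Suc y\<close> may divide it once more.\<close>

lemma rough_set_Suc:
  assumes "prime (Suc y)"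
  shows "rough_set u y = rough_set u (Suc y) \<union> (\<lambda>k. Suc y * k) ` rough_set (u / Suc y) y" (is "_ = ?A \<union> ?B")
proof (intro set_eqI iffI)
  fix m assume m: "m \<in> rough_set u y"
  show "m \<in> ?A \<union> ?B"
  proof (cases "Suc y dvd m")
    case True
    then obtain k where k: "m = Suc y * k" by blast
    then have "k \<in> rough_set (u / Suc y) y"
      using m by (auto simp: rough_set_def field_simps)
    with k show ?thesis by blast
  next
    case False
    then show ?thesis using m by (auto simp: rough_set_def intro: Suc_lessI)
  qed
next
  fix m assume "m \<in> ?A \<union> ?B"
  then show "m \<in> rough_set u y"
  proof
    assume "m \<in> ?A"
    then show ?thesis by (auto simp: rough_set_def)
  next
    assume "m \<in> ?B"
    then obtain k where k: "m = Suc y * k" "k \<in> rough_set (u / Suc y) y" by blast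
    have "y < p" if "prime p" "p dvd Suc y * k" for p
    proof -
      have "p dvd Suc y \<or> p dvd k" using that by (simp add: prime_dvd_mult_iff del: mult_Suc)
      then show ?thesis using that k assms by (auto simp: rough_set_def dest: primes_dvd_imp_eq)
    qed
    then show ?thesis using k by (auto simp: rough_set_def field_simps)
  qed
qed

lemma mertens_prod_Suc:
  "mertens_prod (Suc y) = (if prime (Suc y) then 1 - 1 / Suc y else 1) * mertens_prod y"
proof -
  have "{p. prime p \<and> p \<le> Suc y} =
      (if prime (Suc y) then insert (Suc y) {p. prime p \<and> p \<le> y} else {p. prime p \<and> p \<le> y})"
    by (auto simp: le_Suc_eq)
  then show ?thesis by (simp add: mertens_prod_def)
qed

text \<open>The main term u \<open>mertens_prod y\<close> obeys the same recursion as the count, so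
  the error does too.\<close>

lemma rough_error_Suc:
  "rough_error u (Suc y) =
     rough_error u y - (if prime (Suc y) then rough_error (u / Suc y) y else 0)"
proof (cases "prime (Suc y)")
  case True
  have "card (rough_set u y) =
      card (rough_set u (Suc y)) + card ((\<lambda>k. Suc y * k) ` rough_set (u / Suc y) y)"
    unfolding rough_set_Suc[OF True, of u] using True
    by (intro card_Un_disjoint finite_imageI finite_rough_set) (auto simp: rough_set_def simp del: mult_Suc)
  also have "card ((\<lambda>k. Suc y * k) ` rough_set (u / Suc y) y) = card (rough_set (u / Suc y) y)"
    by (intro card_image inj_onI) (simp del: mult_Suc)
  finally show ?thesis using True
    by (simp add: rough_error_def mertens_prod_Suc algebra_simps)
next
  case False
  then have "rough_set u (Suc y) = rough_set u y"
    by (auto simp: rough_set_def intro: Suc_lessI)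
  with False show ?thesis by (simp add: rough_error_def mertens_prod_Suc)
qed

text \<open>The error at most doubles with each level. Crude in y but uniform in u, this serves
  bounded y and limits where u tends to infinity with y fixed.\<close>

lemma rough_error_le_power:
  "0 \<le> u \<Longrightarrow> \<bar>rough_error u y\<bar> \<le> 2 ^ y"
proof (induction y arbitrary: u)
  case 0
  then show ?case using rough_error_0 by simp
next
  case (Suc y)
  have "\<bar>rough_error u y\<bar> \<le> 2 ^ y" "\<bar>rough_error (u / Suc y) y\<bar> \<le> 2 ^ y"
    using Suc.prems by (auto intro!: Suc.IH simp del: of_nat_Suc)
  then show ?case by (auto simp: rough_error_Suc)
qed

text \<open>Iterates the one-step recursion. The term of p accounts for the integers with least
  prime factor p; their cofactors have only primes >= p, hence the level p - 1.\<close>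

lemma buchstab_identity:
  assumes "z \<le> y"
  shows "rough_error u y =
    rough_error u z - (\<Sum>p | prime p \<and> z < p \<and> p \<le> y. rough_error (u / real p) (p - 1))"
  using assms
proof (induction y rule: dec_induct)
  case base
  have "{p. prime p \<and> z < p \<and> p \<le> z} = {}" by auto
  then show ?case by (simp only: sum.empty)
next
  case (step y)
  have "{p. prime p \<and> z < p \<and> p \<le> Suc y} =
      (if prime (Suc y) then insert (Suc y) {p. prime p \<and> z < p \<and> p \<le> y}
       else {p. prime p \<and> z < p \<and> p \<le> y})"
    using step.hyps by (auto simp: le_Suc_eq)
  then show ?case using step.IH by (simp add: rough_error_Suc)
qed

text \<open>The members are composed of primes in (y, u], so the Euler product applies, with 1 / (1
  - 1/p) <= exp (2/p). The sum of 1/p over this range is at most 8(K + 2), where 1 <= 2 ln y absorbs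
  the additive constant.\<close>

lemma sum_inverse_rough_set_le:
  assumes "2 \<le> y" "real y \<le> u" "ln u \<le> K * ln (real y)"
  shows "(\<Sum>m\<in>rough_set u y. 1 / real m) \<le> exp (16 * (K + 2))"
proof -
  define U where "U = nat \<lfloor>u\<rfloor>"
  have ly: "1 / 2 \<le> ln (real y)" using assms by (intro ln_ge_half) simp
  have yU: "y \<le> U" "real U \<le> u" using assms by (auto simp: U_def le_nat_floor)
  let ?S = "{p. prime p \<and> y < p \<and> p \<le> U}"
  have "(\<Sum>m\<in>rough_set u y. 1 / real m) \<le> (\<Prod>p\<in>?S. 1 / (1 - 1 / real p))"
  proof (intro sum_inverse_le_euler_prod conjI)
    fix m assume m: "m \<in> rough_set u y"
    then show "0 < m" by (simp add: rough_set_def)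
    have "m \<le> U" using m by (auto simp: rough_set_def U_def le_nat_floor)
    then show "prime_factors m \<subseteq> ?S"
      using m by (auto simp: rough_set_def prime_factors_dvd intro: order_trans[OF dvd_imp_le])
  qed auto
  also have "\<dots> \<le> (\<Prod>p\<in>?S. exp (2 * (1 / real p)))"
  proof (intro prod_mono conjI)
    fix p assume p: "p \<in> ?S"
    then have p2: "2 \<le> real p" using assms by simp
    then show "0 \<le> 1 / (1 - 1 / real p)" by simp
    have "1 / (1 - 1 / real p) \<le> 1 + 2 * (1 / real p)" using p2 by (simp add: field_simps)
    also have "\<dots> \<le> exp (2 * (1 / real p))" by (rule exp_ge_add_one_self)
    finally show "1 / (1 - 1 / real p) \<le> exp (2 * (1 / real p))" .
  qed
  also have "\<dots> = exp (2 * (\<Sum>p\<in>?S. 1 / real p))"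
    by (simp add: exp_sum sum_distrib_left)
  also have "\<dots> \<le> exp (2 * (8 * (K + 2)))"
  proof -
    have "(\<Sum>p\<in>?S. 1 / real p) \<le> 8 * (ln (real U / real y) + 1) / ln (real y)"
      using assms yU by (intro sum_inverse_primes_le)
    also have "\<dots> \<le> 8 * (K * ln (real y) + 2 * ln (real y)) / ln (real y)"
    proof (intro divide_right_mono mult_left_mono add_mono)
      have "ln (real U / real y) \<le> ln u" using yU assms by (intro ln_mono) (auto simp: field_simps intro: order_trans[of _ "u * 1"] mult_left_mono)
      then show "ln (real U / real y) \<le> K * ln (real y)" using assms by linarith
    qed (use ly in auto)
    also have "\<dots> = 8 * (K + 2)" using ly by (simp add: field_simps)
    finally show ?thesis by simp
  qed
  finally show ?thesis by simp
qed

text \<open>Writing each rough \<open>n \<noteq> 1\<close> as \<open>p * m\<close> with a prime \<open>p > y\<close> and a rough \<open>m\<close> gives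
  \<open>(card - 1) * ln y \<le> \<Sum>\<^sub>m \<vartheta>(u / m)\<close>, to which Chebyshev's bound applies.\<close>

lemma card_rough_set_le:
  assumes "2 \<le> y" "real y \<le> u" "ln u \<le> K * ln (real y)"
  shows "real (card (rough_set u y)) \<le> 5 * exp (16 * (K + 2)) * u / ln (real y)"
proof -
  let ?R = "rough_set u y"
  have ly: "1 / 2 \<le> ln (real y)" using assms by (intro ln_ge_half) simp
  have u2: "2 \<le> u" using assms by simp
  define q where "q n = (SOME p. prime p \<and> p dvd n)" for n :: nat
  have q: "prime (q n) \<and> q n dvd n" if "n \<noteq> 1" for n
    unfolding q_def using prime_factor_nat[OF that] by (rule someI_ex)
  define f where "f n = (n div q n, q n)" for n
  \<comment> \<open>The condition p > y is dropped here, so that the inner sum over p becomes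
    exactly \<open>chebyshev_theta\<close> at u/m.\<close>
  define T where "T = Sigma ?R (\<lambda>m. {p. prime p \<and> p \<le> nat \<lfloor>u / real m\<rfloor>})"
  have "inj_on f (?R - {1})"
  proof (rule inj_onI)
    fix a b assume "a \<in> ?R - {1}" "b \<in> ?R - {1}" "f a = f b"
    then show "a = b" using q[of a] q[of b] by (metis Diff_iff dvd_div_mult_self f_def insertCI prod.inject)
  qed
  moreover have "f ` (?R - {1}) \<subseteq> T"
  proof
    fix x assume "x \<in> f ` (?R - {1})"
    then obtain n where n: "n \<in> ?R" "n \<noteq> 1" "x = f n" by blast
    obtain m where m: "q n * m = n" using q[OF n(2)] by (metis dvd_def)
    have q0: "0 < q n" using q[OF n(2)] by (auto intro: prime_gt_0_nat)
    have "m dvd n" using m dvd_triv_right[of m "q n"] by simp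
    moreover have m0: "0 < m" using m n by (cases "m = 0") (auto simp: rough_set_def)
    moreover have "real m \<le> u"
      using n dvd_imp_le[OF \<open>m dvd n\<close>] by (simp add: rough_set_def)
    ultimately have "m \<in> ?R"
      using n by (auto simp: rough_set_def intro: dvd_trans)
    moreover have "real (q n) \<le> u / real m"
      using n m m0 by (simp add: rough_set_def pos_le_divide_eq flip: of_nat_mult)
    then have "q n \<le> nat \<lfloor>u / real m\<rfloor>" by (simp add: le_nat_floor)
    moreover have "n div q n = m" using nonzero_mult_div_cancel_left[of "q n" m] m q0 by simp
    ultimately show "x \<in> T" using n q[OF n(2)] by (simp add: T_def f_def)
  qed
  moreover have "finite T" unfolding T_def by (intro finite_SigmaI) auto
  ultimately have "(\<Sum>n\<in>?R - {1}. ln (real (snd (f n)))) \<le> (\<Sum>x\<in>T. ln (real (snd x)))"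
    by (subst sum.reindex[symmetric, unfolded comp_def, of f]) 
      (auto simp: T_def Suc_le_eq intro!: sum_mono2 dest: prime_gt_0_nat)
  moreover have "real (card (?R - {1})) * ln (real y) \<le> (\<Sum>n\<in>?R - {1}. ln (real (snd (f n))))"
  proof (rule sum_bounded_below)
    fix n assume n: "n \<in> ?R - {1}"
    then have "y < q n" using q[of n] by (auto simp: rough_set_def)
    then show "ln (real y) \<le> ln (real (snd (f n)))" using assms by (simp add: f_def)
  qed
  moreover have "(\<Sum>x\<in>T. ln (real (snd x))) = (\<Sum>m\<in>?R. chebyshev_theta (nat \<lfloor>u / real m\<rfloor>))"
    unfolding T_def chebyshev_theta_def by (subst sum.Sigma) (auto simp: case_prod_beta)
  moreover have "\<dots> \<le> (\<Sum>m\<in>?R. 4 * u * (1 / real m))"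
  proof (rule sum_mono)
    fix m assume "m \<in> ?R"
    then have m: "0 < m" by (simp add: rough_set_def)
    have "chebyshev_theta (nat \<lfloor>u / real m\<rfloor>) \<le> 4 * ln 2 * real (nat \<lfloor>u / real m\<rfloor>)"
      by (rule chebyshev_theta_le)
    also have "\<dots> \<le> 4 * 1 * (u / real m)"
      using u2 m ln_2_less_1 by (intro mult_mono) auto
    finally show "chebyshev_theta (nat \<lfloor>u / real m\<rfloor>) \<le> 4 * u * (1 / real m)" by simp
  qed
  moreover have "\<dots> = 4 * u * (\<Sum>m\<in>?R. 1 / real m)" by (simp add: sum_distrib_left)
  moreover have "\<dots> \<le> 4 * u * exp (16 * (K + 2))"
    using assms u2 by (intro mult_left_mono sum_inverse_rough_set_le) auto
  ultimately have "real (card (?R - {1})) * ln (real y) \<le> 4 * u * exp (16 * (K + 2))" by linarith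
  then have "real (card (?R - {1})) \<le> 4 * u * exp (16 * (K + 2)) / ln (real y)"
    using ly by (simp add: field_simps)
  moreover have "real (card ?R) \<le> real (card (?R - {1})) + 1"
    by (cases "1 \<in> ?R") auto
  \<comment> \<open>The integer 1 has no prime to split off and is counted separately; it turns the
    factor 4 into 5.\<close>
  moreover have "1 \<le> exp (16 * (K + 2)) * u / ln (real y)"
  proof -
    have "1 * ln (real y) \<le> ln u" using assms by simp
    then have "1 * ln (real y) \<le> K * ln (real y)" using assms by linarith
    then have "1 \<le> K" using ly by (subst (asm) mult_le_cancel_right) auto
    then have "1 \<le> exp (16 * (K + 2))" by simp
    moreover have "ln (real y) \<le> u" using ln_le_minus_one[of "real y"] assms by simp
    ultimately have "1 * ln (real y) \<le> exp (16 * (K + 2)) * u" using ly u2 by (intro mult_mono) auto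
    then show ?thesis using ly by simp
  qed
  moreover have "4 * u * exp (16 * (K + 2)) / ln (real y) + exp (16 * (K + 2)) * u / ln (real y) =
      5 * exp (16 * (K + 2)) * u / ln (real y)"
    by (simp add: add_divide_distrib[symmetric])
  ultimately show ?thesis by linarith
qed

section \<open>The fundamental lemma of the sieve\<close>

definition sieve_bound :: "real \<Rightarrow> real \<Rightarrow> real" where
  "sieve_bound u y = u / ln y * exp (- (ln u / (3 * ln y)))"

lemma sieve_bound_nonneg: "0 \<le> u \<Longrightarrow> 2 \<le> y \<Longrightarrow> 0 \<le> sieve_bound u y"
  by (simp add: sieve_bound_def)

text \<open>The left factor times ln y is u^(1 - 1/(3 ln y)), with nonnegative exponent because 3 ln
  y >= 1. For bounded y this turns a constant error into a multiple of
  \<open>sieve_bound\<close>.\<close>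

lemma sieve_bound_times_ln_ge_1:
  assumes "2 \<le> y" "1 \<le> u"
  shows "1 \<le> sieve_bound u y * ln y"
proof -
  have ly: "1 / 2 \<le> ln y" using assms by (intro ln_ge_half)
  have "1 / 3 \<le> ln y" using ly by simp
  then have "ln u / (3 * ln y) \<le> ln u / 1"
    using assms ly by (intro divide_left_mono) auto
  then have "exp (- ln u) \<le> exp (- (ln u / (3 * ln y)))" by simp
  then have "u * exp (- ln u) \<le> u * exp (- (ln u / (3 * ln y)))"
    using assms by (intro mult_left_mono) auto
  also have "u * exp (- ln u) = 1" using assms by (simp add: exp_minus)
  finally show ?thesis using ly by (simp add: sieve_bound_def)
qed

text \<open>For u <= y^K the exponential factor in \<open>sieve_bound\<close> is at least exp
  (-K/3), so it is enough that the count and the main term are both O(u / ln y).\<close>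

lemma rough_error_short_range:
  assumes "2 \<le> y" "real y \<le> u" "ln u \<le> K * ln (real y)"
  shows "\<bar>rough_error u y\<bar> \<le> (5 * exp (16 * (K + 2)) + 1) * exp (K / 3) * sieve_bound u y"
proof -
  have ly: "1 / 2 \<le> ln (real y)" using assms by (intro ln_ge_half) simp
  have "\<bar>rough_error u y\<bar> \<le> real (card (rough_set u y)) + u * mertens_prod y"
    using mertens_prod_pos[of y] assms unfolding rough_error_def by (simp add: abs_if)
  also have "\<dots> \<le> 5 * exp (16 * (K + 2)) * u / ln (real y) + u * (1 / ln (real y))"
    using assms by (intro add_mono card_rough_set_le mult_left_mono mertens_prod_le) auto
  also have "\<dots> = (5 * exp (16 * (K + 2)) + 1) * (u / ln (real y))" by (simp add: algebra_simps add_divide_distrib)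
  also have "u / ln (real y) \<le> u / ln (real y) * exp (K / 3 - ln u / (3 * ln (real y)))"
  proof -
    have "ln u / (3 * ln (real y)) \<le> K / 3" using assms(3) ly by (simp add: divide_le_eq)
    then have "1 \<le> exp (K / 3 - ln u / (3 * ln (real y)))" by simp
    then have "u / ln (real y) * 1 \<le> u / ln (real y) * exp (K / 3 - ln u / (3 * ln (real y)))"
      using assms ly by (intro mult_left_mono) auto
    then show ?thesis by simp
  qed
  also have "\<dots> = exp (K / 3) * sieve_bound u y"
    unfolding sieve_bound_def diff_conv_add_uminus exp_add by simp
  finally show ?thesis by (simp only: mult.assoc) (simp add: mult_left_mono)
qed

text \<open>Lowering the level to y^(199/200) multiplies ln u / ln y by at least 200/199. As this
  ratio is at least 3000, the exponent gains 3000/597 > 3, and exp (-3) <= 1/4 outweighs the factor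
  2 lost in 1 / ln z.\<close>

lemma sieve_bound_lower_level:
  assumes z: "1 < z" "ln z \<le> 199/200 * ln y" "ln y \<le> 2 * ln z"
    and u: "1 \<le> u" "3000 * ln y \<le> ln u"
  shows "sieve_bound u z \<le> 1 / 2 * sieve_bound u y"
proof -
  have lz: "0 < ln z" using z by simp
  then have ly: "0 < ln y" using z by linarith
  have "200 * (ln u / (199 * ln y)) = ln u / (199 / 200 * ln y)" by simp
  also have "\<dots> \<le> ln u / ln z" using u z lz ly by (intro divide_left_mono) auto
  finally have "200/199 * (ln u / ln y) \<le> ln u / ln z" by simp
  moreover have "3000 \<le> ln u / ln y" using u ly by (simp add: field_simps)
  ultimately have exponent: "- (ln u / (3 * ln z)) \<le> - (ln u / (3 * ln y)) - 3" by simp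
  have "sieve_bound u z = u * (1 / ln z) * exp (- (ln u / (3 * ln z)))"
    by (simp add: sieve_bound_def)
  also have "\<dots> \<le> u * (2 / ln y) * exp (- (ln u / (3 * ln y)) - 3)"
  proof (intro mult_mono mult_left_mono)
    show "1 / ln z \<le> 2 / ln y"
      using z(3) lz ly by (simp add: divide_le_eq pos_le_divide_eq del: ln_gt_zero_iff)
  qed (use u lz ly exponent in auto)
  also have "\<dots> = 2 / exp 3 * sieve_bound u y"
    by (simp add: sieve_bound_def exp_diff mult_ac)
  also have "\<dots> \<le> 1 / 2 * sieve_bound u y"
  proof (rule mult_right_mono)
    have "4 \<le> exp (3::real)" using exp_ge_add_one_self[of 3] by simp
    then show "2 / exp 3 \<le> (1 / 2 :: real)" by (simp add: field_simps)
    show "0 \<le> sieve_bound u y" using u ly by (simp add: sieve_bound_def)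
  qed
  finally show ?thesis .
qed

text \<open>Passing from u to u/p lowers ln u / (3 ln p) by exactly 1/3, while the level p - 1 <= y
  only helps the exponent. The loss is exp (1/3) <= 3 there and 2 from the logarithm in the
  denominator, together 6.\<close>

lemma sieve_bound_buchstab_term:
  assumes z: "1 < z" "ln y \<le> 2 * ln z" "z \<le> p - 1" "p \<le> y" and u: "p \<le> u"
  shows "sieve_bound (u / p) (p - 1) \<le> 6 * sieve_bound u y * (1 / p)"
proof -
  have pos: "0 < ln z" "0 < ln (p - 1)" "ln z \<le> ln (p - 1)" "ln (p - 1) \<le> ln p" "ln p \<le> ln y" "0 < p"
    "0 < ln p" "0 < ln y"
    using z by auto
  have up: "0 \<le> ln (u / p)" using u pos by simp
  have "ln u / (3 * ln y) \<le> ln u / (3 * ln p)"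
    using u z pos by (intro divide_left_mono) auto
  also have "ln u / (3 * ln p) = ln (u / p) / (3 * ln p) + 1 / 3"
    using u pos by (simp add: ln_div diff_divide_distrib)
  also have "ln (u / p) / (3 * ln p) \<le> ln (u / p) / (3 * ln (p - 1))"
    using up pos z by (intro divide_left_mono mult_pos_pos) auto
  finally have exponent: "- (ln (u / p) / (3 * ln (p - 1))) \<le> 1 / 3 - ln u / (3 * ln y)" by simp
  have "sieve_bound (u / p) (p - 1) = u / p * (1 / ln (p - 1)) * exp (- (ln (u / p) / (3 * ln (p - 1))))"
    by (simp add: sieve_bound_def)
  also have "\<dots> \<le> u / p * (2 / ln y) * exp (1 / 3 - ln u / (3 * ln y))"
  proof (intro mult_mono mult_left_mono)
    have "ln y \<le> 2 * ln (p - 1)" using z(2) pos(3) by linarith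
    then show "1 / ln (p - 1) \<le> 2 / ln y"
      using pos(2,8) by (simp add: divide_le_eq pos_le_divide_eq del: ln_gt_zero_iff)
  qed (use u z pos exponent in auto)
  also have "\<dots> = 2 * exp (1 / 3) * (sieve_bound u y * (1 / p))"
    unfolding sieve_bound_def diff_conv_add_uminus exp_add by (simp add: mult_ac)
  also have "\<dots> \<le> 6 * (sieve_bound u y * (1 / p))"
  proof (rule mult_right_mono)
    have "exp (1 / 3) \<le> exp (1::real)" by simp
    then show "2 * exp (1 / 3) \<le> (6::real)" using exp_le by linarith
    show "0 \<le> sieve_bound u y * (1 / p)" using u pos z by (simp add: sieve_bound_def)
  qed
  finally show ?thesis by simp
qed

text \<open>Take y^(199/200) rounded down; rounding changes ln z by less than 1. The bound 1/12 is
  tuned to the constant 6 of the Buchstab terms, so that their total is half of the target.\<close>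

lemma sieve_level_exists:
  assumes "1000 \<le> ln (real y)"
  obtains z :: nat where "2 \<le> z" "z < y" "ln (real z) \<le> 199/200 * ln (real y)"
    "ln (real y) \<le> 2 * ln (real z)" "(\<Sum>p | prime p \<and> z < p \<and> p \<le> y. 1 / real p) \<le> 1 / 12"
proof
  define Z where "Z = exp (199/200 * ln (real y))"
  define z where "z = nat \<lfloor>Z\<rfloor>"
  have y: "0 < y" using assms by (cases "y = 0") auto
  have "2 \<le> 1 + 199/200 * ln (real y)" using assms by simp
  also have "\<dots> \<le> Z" unfolding Z_def by (rule exp_ge_add_one_self)
  finally have Z: "2 \<le> Z" .
  then show z2: "2 \<le> z" by (simp add: z_def le_nat_floor)
  have zZ: "real z \<le> Z" "Z / 2 \<le> real z" using Z by (simp_all add: z_def) linarith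
  have "ln (real z) \<le> ln Z" using zZ z2 by simp
  then show lz: "ln (real z) \<le> 199/200 * ln (real y)" by (simp add: Z_def)
  have "ln (real z) < ln (real y)" using lz assms by linarith
  then show zy: "z < y" using z2 y by simp
  have "ln (Z / 2) \<le> ln (real z)" using zZ Z by (intro ln_mono) auto
  then have lz': "199/200 * ln (real y) - 1 \<le> ln (real z)"
    using ln_2_less_1 by (simp add: ln_div Z_def)
  then show "ln (real y) \<le> 2 * ln (real z)" using assms by linarith
  have "(\<Sum>p | prime p \<and> z < p \<and> p \<le> y. 1 / real p) \<le> 8 * (ln (y / z) + 1) / ln z"
    using z2 zy by (intro sum_inverse_primes_le) auto
  also have "\<dots> \<le> 1 / 12"
  proof -
    have "ln (y / z) = ln y - ln z" using y z2 by (simp add: ln_div)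
    then have "12 * (8 * (ln (y / z) + 1)) \<le> ln z" using lz' assms by simp
    then show ?thesis using z2 by (simp add: field_simps)
  qed
  finally show "(\<Sum>p | prime p \<and> z < p \<and> p \<le> y. 1 / real p) \<le> 1 / 12" .
qed

text \<open>Strong induction on y with u arbitrary. Small y and the range u <= y^3000 are settled
  directly and determine C; in the remaining case Buchstab's identity reproduces the same C.\<close>

lemma fundamental_lemma:
  obtains C where "0 < C"
    "\<And>u y. 2 \<le> y \<Longrightarrow> real y \<le> u \<Longrightarrow> \<bar>rough_error u y\<bar> \<le> C * sieve_bound u (real y)"
proof
  define Y where "Y = nat \<lceil>exp 1000 :: real\<rceil>"
  define C where "C = max (2 ^ Y * 1000) ((5 * exp (16 * (3000 + 2)) + 1) * exp (3000 / 3 :: real))"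
  have C1: "2 ^ Y * 1000 \<le> C" unfolding C_def by (rule max.cobounded1)
  have C2: "(5 * exp (16 * (3000 + 2)) + 1) * exp (3000 / 3) \<le> C"
    unfolding C_def by (rule max.cobounded2)
  have "0 < (2::real) ^ Y * 1000" by simp
  then show C: "0 < C" using C1 by linarith
  fix u :: real and y :: nat
  assume "2 \<le> y" "real y \<le> u"
  then show "\<bar>rough_error u y\<bar> \<le> C * sieve_bound u (real y)"
  proof (induction y arbitrary: u rule: less_induct)
    case (less y)
    note y = less.prems
    have sb: "0 \<le> sieve_bound u (real y)" using y by (intro sieve_bound_nonneg) auto
    consider "ln (real y) < 1000" | "ln u \<le> 3000 * ln (real y)"
      | "1000 \<le> ln (real y)" "3000 * ln (real y) \<le> ln u" by linarith
    then show ?case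
    proof cases
      case 1
      then have "real y < exp 1000" using y by (subst exp_ln[symmetric, of "real y"]) (auto simp del: exp_ln)
      also have "\<dots> \<le> real Y" unfolding Y_def by linarith
      finally have "y \<le> Y" by simp
      have "\<bar>rough_error u y\<bar> \<le> 2 ^ y" using y by (intro rough_error_le_power) simp
      also have "\<dots> \<le> 2 ^ Y * 1" using \<open>y \<le> Y\<close> by simp
      also have "\<dots> \<le> 2 ^ Y * (sieve_bound u (real y) * ln (real y))"
        using y by (intro mult_left_mono sieve_bound_times_ln_ge_1) auto
      also have "\<dots> \<le> 2 ^ Y * (sieve_bound u (real y) * 1000)"
        using 1 sb by (intro mult_left_mono) auto
      also have "\<dots> = 2 ^ Y * 1000 * sieve_bound u (real y)" by simp
      also have "\<dots> \<le> C * sieve_bound u (real y)"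
        using sb by (intro mult_right_mono C1)
      finally show ?thesis .
    next
      case 2
      have "\<bar>rough_error u y\<bar> \<le> (5 * exp (16 * (3000 + 2)) + 1) * exp (3000 / 3) * sieve_bound u y"
        using y 2 by (intro rough_error_short_range)
      also have "\<dots> \<le> C * sieve_bound u (real y)"
        using sb by (intro mult_right_mono C2)
      finally show ?thesis .
    next
      case 3
      obtain z where z: "2 \<le> z" "z < y" "ln (real z) \<le> 199/200 * ln (real y)"
        "ln (real y) \<le> 2 * ln (real z)" "(\<Sum>p | prime p \<and> z < p \<and> p \<le> y. 1 / real p) \<le> 1 / 12"
        using sieve_level_exists[OF 3(1)] .
      let ?S = "{p. prime p \<and> z < p \<and> p \<le> y}"
      \<comment> \<open>From u >= y^2 follows u/p >= p > p - 1, and z >= 2 gives p - 1 >= 2, so the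
        induction hypothesis covers every Buchstab term.\<close>
      have "ln ((real y)\<^sup>2) \<le> ln u" using y 3 by (simp add: ln_realpow)
      then have yu: "(real y)\<^sup>2 \<le> u" using y by (subst (asm) ln_le_cancel_iff) auto
      have term_le: "\<bar>rough_error (u / real p) (p - 1)\<bar> \<le> C * (6 * sieve_bound u y * (1 / real p))"
        if p: "p \<in> ?S" for p
      proof -
        have p': "2 \<le> p - 1" "p - 1 < y" "p \<le> y" "0 < p" using p z by auto
        have "real p * real p \<le> real y * real y" using p by (intro mult_mono) auto
        then have pu: "real p \<le> u / real p"
          using yu p' by (simp add: pos_le_divide_eq power2_eq_square)
        have "real (p - 1) \<le> real p" by simp
        also note pu
        finally have "\<bar>rough_error (u / real p) (p - 1)\<bar> \<le> C * sieve_bound (u / real p) (real (p - 1))"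
          using p' by (intro less.IH) auto
        also have "\<dots> \<le> C * (6 * sieve_bound u y * (1 / real p))"
        proof (intro mult_left_mono)
          have "1 \<le> real y" using y by simp
          then have "real y * 1 \<le> real y * real y" by (intro mult_left_mono) auto
          moreover have "real p \<le> real y" using p by simp
          ultimately have "real p \<le> u" using yu unfolding power2_eq_square by linarith
          then show "sieve_bound (u / real p) (real (p - 1)) \<le> 6 * sieve_bound u y * (1 / real p)"
            using p p' z sieve_bound_buchstab_term[of "real z" "real y" "real p" u]
            by (simp add: of_nat_diff)
        qed (use C in simp)
        finally show ?thesis .
      qed
      have "rough_error u y =
          rough_error u z - (\<Sum>p\<in>?S. rough_error (u / real p) (p - 1))"
        using z by (intro buchstab_identity) simp
      then have "\<bar>rough_error u y\<bar> \<le>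
          \<bar>rough_error u z\<bar> + \<bar>\<Sum>p\<in>?S. rough_error (u / real p) (p - 1)\<bar>"
        by linarith
      \<comment> \<open>The two contributions are C/2 from level z and 6C/12 from the primes, adding
        up to C.\<close>
      also have "\<dots> \<le> C * (1 / 2 * sieve_bound u y) + (\<Sum>p\<in>?S. C * (6 * sieve_bound u y * (1 / real p)))"
      proof (intro add_mono)
        have "\<bar>rough_error u z\<bar> \<le> C * sieve_bound u (real z)"
          using y z by (intro less.IH) auto
        also have "\<dots> \<le> C * (1 / 2 * sieve_bound u y)"
          using C y z 3 by (intro mult_left_mono sieve_bound_lower_level) auto
        finally show "\<bar>rough_error u z\<bar> \<le> C * (1 / 2 * sieve_bound u y)" .
        show "\<bar>\<Sum>p\<in>?S. rough_error (u / real p) (p - 1)\<bar> \<le>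
            (\<Sum>p\<in>?S. C * (6 * sieve_bound u y * (1 / real p)))"
          by (intro order_trans[OF sum_abs] sum_mono term_le)
      qed
      also have "(\<Sum>p\<in>?S. C * (6 * sieve_bound u y * (1 / real p))) =
          C * (6 * sieve_bound u y) * (\<Sum>p\<in>?S. 1 / real p)"
        by (simp add: sum_distrib_left mult_ac)
      also have "\<dots> \<le> C * (6 * sieve_bound u y) * (1 / 12)"
        using z C sb by (intro mult_left_mono) auto
      finally show ?thesis by simp
    qed
  qed
qed

section \<open>Unique decomposition over the set \<open>\<B>\<close>\<close>

text \<open>For p = \<open>p\<^sub>j\<^sub>+\<^sub>1\<close> this is the partial product of the
  first j prime powers of n, expressed without indices.\<close>

definition part_below :: "nat \<Rightarrow> nat \<Rightarrow> nat" where
  "part_below n p = (\<Prod>q\<in>{q \<in> prime_factors n. q < p}. q ^ multiplicity q n)"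

text \<open>The list is strictly increasing, so its entries before position j are exactly the prime
  factors smaller than entry j.\<close>

lemma prime_seq_prod_eq_part_below:
  assumes "j < length (prime_seq n)"
  shows "(\<Prod>i<j. (prime_seq n ! i) ^ multiplicity (prime_seq n ! i) n) =
    part_below n (prime_seq n ! j)"
proof -
  let ?xs = "prime_seq n"
  have sorted: "sorted_wrt (<) ?xs" and set: "set ?xs = prime_factors n"
    by (simp_all add: prime_seq_def)
  have less: "?xs ! i < ?xs ! k" if "i < k" "k < length ?xs" for i k
    using sorted_wrt_nth_less[OF sorted that] .
  have inj: "inj_on (\<lambda>i. ?xs ! i) {..<j}"
  proof (rule linorder_inj_onI)
    fix a b assume "a < b" "a \<in> {..<j}" "b \<in> {..<j}"
    then have "?xs ! a < ?xs ! b" using assms by (intro less) auto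
    then show "?xs ! a \<noteq> ?xs ! b" by simp
  qed auto
  have "{q \<in> prime_factors n. q < ?xs ! j} = (\<lambda>i. ?xs ! i) ` {..<j}"
  proof (intro set_eqI iffI)
    fix q assume q: "q \<in> {q \<in> prime_factors n. q < ?xs ! j}"
    then obtain i where i: "i < length ?xs" "q = ?xs ! i"
      unfolding set[symmetric] by (auto simp: in_set_conv_nth)
    have "i < j"
    proof (rule ccontr)
      assume "\<not> i < j"
      then have "?xs ! j \<le> ?xs ! i" using less[of j i] i by (cases "i = j") auto
      then show False using q i by simp
    qed
    then show "q \<in> (\<lambda>i. ?xs ! i) ` {..<j}" using i by blast
  next
    fix q assume "q \<in> (\<lambda>i. ?xs ! i) ` {..<j}"
    then show "q \<in> {q \<in> prime_factors n. q < ?xs ! j}"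
      unfolding set[symmetric] using assms less by auto
  qed
  then show ?thesis unfolding part_below_def using inj by (simp add: sum.reindex prod.reindex)
qed

text \<open>Replaces positions by primes; the separately listed element 1 fits in because it has no
  prime factors.\<close>

lemma in_\<B>_iff:
  "n \<in> \<B> \<theta> \<longleftrightarrow> 0 < n \<and> (\<forall>p\<in>prime_factors n. ereal (real p) \<le> \<theta> (part_below n p))"
proof -
  have "(\<forall>j<length (prime_seq n). ereal (real (prime_seq n ! j))
          \<le> \<theta> (\<Prod>i<j. (prime_seq n ! i) ^ multiplicity (prime_seq n ! i) n)) \<longleftrightarrow>
        (\<forall>p\<in>set (prime_seq n). ereal (real p) \<le> \<theta> (part_below n p))"
    by (simp add: prime_seq_prod_eq_part_below all_set_conv_all_nth)
  moreover have "set (prime_seq n) = prime_factors n" by (simp add: prime_seq_def)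
  moreover have "prime_factors (1::nat) = {}" by simp
  ultimately show ?thesis
    unfolding \<B>_def by (cases "n = 1") (auto simp: Suc_le_eq numeral_2_eq_2)
qed

lemma multiplicity_part_below:
  assumes "prime q"
  shows "multiplicity q (part_below n p) = (if q \<in> prime_factors n \<and> q < p then multiplicity q n else 0)"
  unfolding part_below_def using assms
  by (subst multiplicity_prod_prime_powers) (auto dest: in_prime_factors_imp_prime)

lemma part_below_pos: "0 < part_below n p"
  unfolding part_below_def
  by (intro prod_pos zero_less_power prime_gt_0_nat) (auto intro: in_prime_factors_imp_prime)

lemma prime_factors_part_below:
  "prime_factors (part_below n p) = {q \<in> prime_factors n. q < p}"
proof (intro set_eqI iffI)
  fix q assume "q \<in> prime_factors (part_below n p)"
  then have "prime q" "multiplicity q (part_below n p) > 0"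
    by (simp_all add: prime_factors_multiplicity)
  then show "q \<in> {q \<in> prime_factors n. q < p}"
    by (simp add: multiplicity_part_below split: if_splits)
next
  fix q assume "q \<in> {q \<in> prime_factors n. q < p}"
  then have "prime q" "multiplicity q n > 0" "q \<in> prime_factors n" "q < p"
    by (simp_all add: prime_factors_multiplicity)
  then have "multiplicity q (part_below n p) > 0" by (simp add: multiplicity_part_below)
  then show "q \<in> prime_factors (part_below n p)"
    using \<open>prime q\<close> by (simp add: prime_factors_multiplicity)
qed

lemma part_below_part_below:
  assumes "q \<le> p"
  shows "part_below (part_below n p) q = part_below n q"
proof -
  have "{r \<in> prime_factors (part_below n p). r < q} = {r \<in> prime_factors n. r < q}"
    using assms by (auto simp: prime_factors_part_below)
  then show ?thesis
    unfolding part_below_def[of "part_below n p"] part_below_def[of n q]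
    using assms in_prime_factors_imp_prime[of _ n]
    by (intro prod.cong) (auto simp: multiplicity_part_below)
qed

lemma part_below_cofactor:
  assumes "0 < n"
  obtains r where "n = part_below n p * r" "\<And>q. prime q \<Longrightarrow> q dvd r \<Longrightarrow> q \<in> prime_factors n \<and> p \<le> q"
proof
  let ?r = "\<Prod>q\<in>{q \<in> prime_factors n. p \<le> q}. q ^ multiplicity q n"
  have "part_below n p * ?r =
      (\<Prod>q\<in>{q \<in> prime_factors n. q < p} \<union> {q \<in> prime_factors n. p \<le> q}. q ^ multiplicity q n)"
    unfolding part_below_def by (subst prod.union_disjoint) auto
  also have "{q \<in> prime_factors n. q < p} \<union> {q \<in> prime_factors n. p \<le> q} = prime_factors n" by auto
  also have "(\<Prod>q\<in>prime_factors n. q ^ multiplicity q n) = n"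
    using prime_factorization_nat[OF assms] by (rule sym)
  finally show "n = part_below n p * ?r" by (rule sym)
  fix q assume q: "prime q" "q dvd ?r"
  then obtain s where "s \<in> prime_factors n" "p \<le> s" "q dvd s ^ multiplicity s n"
    by (auto simp: prime_dvd_prod_iff)
  moreover from this have "q = s"
    using q(1) prime_dvd_power[of q s] primes_dvd_imp_eq[of q s] in_prime_factors_imp_prime[of s n] by simp
  ultimately show "q \<in> prime_factors n \<and> p \<le> q" by simp
qed

text \<open>Separates the primes of n from those exceeding \<theta>(n), on which the uniqueness of
  the decomposition rests.\<close>

lemma admissible_prime_factor_le:
  assumes "admissible \<theta>" "p \<in> prime_factors n"
  shows "ereal (real p) \<le> \<theta> n"
proof -
  have "prime p" "p dvd n" "0 < n" using assms(2) by (auto simp: in_prime_factors_iff)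
  then have "2 \<le> n" using dvd_imp_le prime_ge_2_nat order_trans by blast
  then have "ereal (real (largest_prime_factor n)) \<le> \<theta> n" using assms by (simp add: admissible_def)
  moreover have "p \<le> largest_prime_factor n"
    unfolding largest_prime_factor_def using assms by (intro Max_ge) auto
  ultimately show ?thesis by (meson ereal_less_eq(3) of_nat_mono order_trans)
qed

lemma admissible_ge_2:
  assumes "admissible \<theta>" "0 < n"
  shows "2 \<le> \<theta> n"
proof (cases "n = 1")
  case True
  then show ?thesis using assms by (simp add: admissible_def)
next
  case False
  then obtain p where p: "prime p" "p dvd n" using prime_factor_nat by blast
  then have "ereal (real p) \<le> \<theta> n"
    using assms by (intro admissible_prime_factor_le) (auto simp: in_prime_factors_iff)
  moreover have "2 \<le> ereal (real p)" using prime_ge_2_nat[OF p(1)] by (simp add: numeral_eq_ereal)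
  ultimately show ?thesis by (rule order_trans[rotated])
qed

section \<open>Existence and uniqueness of the decomposition, and the resulting count\<close>

definition cofactors :: "(nat \<Rightarrow> ereal) \<Rightarrow> real \<Rightarrow> nat \<Rightarrow> nat set" where
  "cofactors \<theta> u n =
     {r. 0 < r \<and> real r \<le> u \<and> (\<forall>p. prime p \<longrightarrow> p dvd r \<longrightarrow> \<theta> n < ereal (real p))}"

text \<open>Cut m at the least prime p violating the defining condition: the part below p satisfies
  it, and all remaining primes are at least p, hence exceed \<theta> of that part. If no prime
  violates it, m itself is taken with cofactor 1.\<close>

lemma \<B>_decomposition_exists:
  assumes "0 < m"
  obtains n r where "m = n * r" "n \<in> \<B> \<theta>" "\<And>p. prime p \<Longrightarrow> p dvd r \<Longrightarrow> \<theta> n < ereal (real p)"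
proof (cases "m \<in> \<B> \<theta>")
  case True
  have "\<theta> m < ereal (real p)" if "prime p" "p dvd 1" for p :: nat
    using that by simp
  then show ?thesis using that[of m 1] True by simp
next
  case False
  define P where "P p \<longleftrightarrow> p \<in> prime_factors m \<and> \<theta> (part_below m p) < ereal (real p)" for p
  define p where "p = (LEAST p. P p)"
  have "\<exists>p. P p" using False assms by (auto simp: in_\<B>_iff P_def not_le)
  then have p: "P p" unfolding p_def by (rule LeastI_ex)
  have least: "\<not> P q" if "q < p" for q using that not_less_Least unfolding p_def by blast
  obtain r where r: "m = part_below m p * r" "\<And>q. prime q \<Longrightarrow> q dvd r \<Longrightarrow> q \<in> prime_factors m \<and> p \<le> q"
    using part_below_cofactor[OF assms, of p] by blast
  show ?thesis
  proof (rule that[OF r(1)])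
    show "part_below m p \<in> \<B> \<theta>"
      unfolding in_\<B>_iff
    proof (intro conjI ballI part_below_pos)
      fix q assume "q \<in> prime_factors (part_below m p)"
      then have q: "q \<in> prime_factors m" "q < p" using assms by (auto simp: prime_factors_part_below)
      then show "ereal (real q) \<le> \<theta> (part_below (part_below m p) q)"
        using least[of q] assms by (simp add: part_below_part_below P_def not_less)
    qed
    fix q assume "prime q" "q dvd r"
    then have "p \<le> q" using r(2) by blast
    then show "\<theta> (part_below m p) < ereal (real q)"
      using p unfolding P_def by (meson ereal_less_eq(3) of_nat_mono order_less_le_trans)
  qed
qed

text \<open>Here q must divide r, so \<theta>(n) < q, and all primes of n lie below q. Then n is the
  part of n' below q, and membership of n' forces q <= \<theta>(n), a contradiction.\<close>

lemma \<B>_decomposition_unique_aux: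
  assumes "admissible \<theta>" and n: "n \<in> \<B> \<theta>" and n': "n' \<in> \<B> \<theta>" and eq: "n * r = n' * r'"
    and r: "\<And>p. prime p \<Longrightarrow> p dvd r \<Longrightarrow> \<theta> n < ereal (real p)"
    and q: "prime q" "q dvd n'" "\<not> q dvd n"
    and agree: "\<And>t. prime t \<Longrightarrow> t < q \<Longrightarrow> multiplicity t n = multiplicity t n'"
  shows False
proof -
  have pos: "0 < n" "0 < n'" using n n' by (auto simp: in_\<B>_iff)
  have "q dvd n * r" unfolding eq using q by simp
  then have "q dvd r" using q by (simp add: prime_dvd_mult_iff)
  then have \<theta>q: "\<theta> n < ereal (real q)" using q r by blast
  have small: "t < q" if "t \<in> prime_factors n" for t
  proof -
    have "ereal (real t) < ereal (real q)"
      using admissible_prime_factor_le[OF assms(1) that] \<theta>q by (rule order_le_less_trans)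
    then show ?thesis by simp
  qed
  have factors: "{t \<in> prime_factors n'. t < q} = prime_factors n"
  proof (intro set_eqI iffI)
    fix t assume "t \<in> {t \<in> prime_factors n'. t < q}"
    then show "t \<in> prime_factors n" using agree[of t] by (simp add: prime_factors_multiplicity)
  next
    fix t assume "t \<in> prime_factors n"
    then show "t \<in> {t \<in> prime_factors n'. t < q}"
      using agree[of t] small[of t] by (simp add: prime_factors_multiplicity)
  qed
  have "part_below n' q = (\<Prod>t\<in>prime_factors n. t ^ multiplicity t n)"
    unfolding part_below_def factors
    by (intro prod.cong refl) (simp add: agree small in_prime_factors_imp_prime)
  also have "\<dots> = n" using prime_factorization_nat[OF pos(1)] by (rule sym)
  finally have "part_below n' q = n" .
  moreover have "q \<in> prime_factors n'" using q pos by (simp add: in_prime_factors_iff)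
  ultimately have "ereal (real q) \<le> \<theta> n" using n' by (auto simp: in_\<B>_iff)
  then show False using \<theta>q by simp
qed

text \<open>Consider the least prime q at which the multiplicities in n and n' differ. If q divides
  both, neither cofactor contains it and both multiplicities equal that in the common product; so it
  divides exactly one, and the auxiliary lemma applies in one of the two directions.\<close>

lemma \<B>_decomposition_unique:
  assumes "admissible \<theta>" and n: "n \<in> \<B> \<theta>" and n': "n' \<in> \<B> \<theta>" and eq: "n * r = n' * r'" and "0 < r"
    and r: "\<And>p. prime p \<Longrightarrow> p dvd r \<Longrightarrow> \<theta> n < ereal (real p)"
    and r': "\<And>p. prime p \<Longrightarrow> p dvd r' \<Longrightarrow> \<theta> n' < ereal (real p)"
  shows "n = n'"
proof (rule ccontr)
  assume neq: "n \<noteq> n'"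
  have pos: "0 < n" "0 < n'" using n n' by (auto simp: in_\<B>_iff)
  \<comment> \<open>A prime of a is at most \<theta>(a), so it cannot divide the cofactor s.\<close>
  have full: "multiplicity t (a * s) = multiplicity t a"
    if "prime t" "t dvd a" "0 < a" "\<And>p. prime p \<Longrightarrow> p dvd s \<Longrightarrow> \<theta> a < ereal (real p)" for t a s
  proof -
    have "ereal (real t) \<le> \<theta> a"
      using that assms(1) by (intro admissible_prime_factor_le) (auto simp: in_prime_factors_iff)
    then have "\<not> t dvd s" using that(1,4) by (meson not_le)
    then show ?thesis using that(1) multiplicity_prime_elem_times_other[of t s a] by (simp add: mult.commute)
  qed
  define P where "P t \<longleftrightarrow> prime t \<and> multiplicity t n \<noteq> multiplicity t n'" for t
  define q where "q = (LEAST t. P t)"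
  have "\<exists>t. P t" using neq pos multiplicity_eq_nat unfolding P_def by blast
  then have q: "P q" unfolding q_def by (rule LeastI_ex)
  have agree: "multiplicity t n = multiplicity t n'" if "prime t" "t < q" for t
    using that not_less_Least unfolding q_def P_def by blast
  have qp: "prime q" using q by (simp add: P_def)
  consider "q dvd n'" "\<not> q dvd n" | "q dvd n" "\<not> q dvd n'"
  proof (cases "q dvd n \<longleftrightarrow> q dvd n'")
    case True
    show ?thesis
    proof (cases "q dvd n")
      case True
      then have "q dvd n'" using \<open>q dvd n \<longleftrightarrow> q dvd n'\<close> by simp
      have "multiplicity q n = multiplicity q (n * r)"
        by (rule full[OF qp True pos(1) r, symmetric])
      also have "\<dots> = multiplicity q n'"
        unfolding eq by (rule full[OF qp \<open>q dvd n'\<close> pos(2) r'])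
      finally have "multiplicity q n = multiplicity q n'" .
      then show ?thesis using q by (simp add: P_def)
    next
      case False
      then have "multiplicity q n = multiplicity q n'"
        using \<open>q dvd n \<longleftrightarrow> q dvd n'\<close> by (simp add: not_dvd_imp_multiplicity_0)
      then show ?thesis using q by (simp add: P_def)
    qed
  qed (use that in blast)
  then show False
  proof cases
    case 1
    then show False using \<B>_decomposition_unique_aux[OF assms(1) n n' eq r qp] agree by blast
  next
    case 2
    then show False
      using \<B>_decomposition_unique_aux[OF assms(1) n' n eq[symmetric] r' qp] agree[symmetric] by blast
  qed
qed

lemma finite_cofactors [simp]: "finite (cofactors \<theta> u n)"
proof (rule finite_subset)
  show "cofactors \<theta> u n \<subseteq> {..nat \<lfloor>u\<rfloor>}" by (auto simp: cofactors_def le_nat_floor)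
qed simp

lemma finite_\<B>_le [simp]: "finite {n. real n \<le> x \<and> n \<in> \<B> \<theta>}"
proof (rule finite_subset)
  show "{n. real n \<le> x \<and> n \<in> \<B> \<theta>} \<subseteq> {..nat \<lfloor>x\<rfloor>}" by (auto simp: le_nat_floor)
qed simp

text \<open>By existence and uniqueness the positive integers up to x are the disjoint union of the
  sets n \<open>cofactors \<theta> (x / real n) n\<close>.\<close>

lemma floor_eq_sum_card_cofactors:
  assumes "admissible \<theta>" "0 \<le> x"
  shows "nat \<lfloor>x\<rfloor> = (\<Sum>n | real n \<le> x \<and> n \<in> \<B> \<theta>. card (cofactors \<theta> (x / real n) n))"
proof -
  let ?A = "{n. real n \<le> x \<and> n \<in> \<B> \<theta>}"
  let ?M = "\<lambda>n. (\<lambda>r. n * r) ` cofactors \<theta> (x / real n) n"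
  have pos: "0 < n" if "n \<in> ?A" for n using that by (auto simp: in_\<B>_iff)
  have "{1..nat \<lfloor>x\<rfloor>} = (\<Union>n\<in>?A. ?M n)"
  proof (intro set_eqI iffI)
    fix m assume m: "m \<in> {1..nat \<lfloor>x\<rfloor>}"
    then have m0: "0 < m" and mx: "real m \<le> x" using assms(2) by (auto, linarith)
    obtain n r where nr: "m = n * r" "n \<in> \<B> \<theta>" "\<And>p. prime p \<Longrightarrow> p dvd r \<Longrightarrow> \<theta> n < ereal (real p)"
      using \<B>_decomposition_exists[OF m0, of \<theta>] by blast
    have r0: "0 < r" "0 < n" using nr m0 by auto
    have "n \<le> m" using nr r0 by simp
    then have "n \<in> ?A" using nr(2) mx by (simp only: mem_Collect_eq) (meson of_nat_mono order_trans)
    moreover have "r \<in> cofactors \<theta> (x / real n) n"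
      using nr r0 mx by (auto simp: cofactors_def pos_le_divide_eq mult.commute)
    ultimately show "m \<in> (\<Union>n\<in>?A. ?M n)" using nr by blast
  next
    fix m assume "m \<in> (\<Union>n\<in>?A. ?M n)"
    then obtain n r where nr: "n \<in> ?A" "r \<in> cofactors \<theta> (x / real n) n" "m = n * r" by blast
    then have "real m \<le> x" "0 < m"
      using pos[OF nr(1)] by (auto simp: cofactors_def pos_le_divide_eq mult.commute)
    then show "m \<in> {1..nat \<lfloor>x\<rfloor>}" by (auto simp: le_nat_floor)
  qed
  then have "nat \<lfloor>x\<rfloor> = card (\<Union>n\<in>?A. ?M n)" using card_atLeastAtMost[of 1 "nat \<lfloor>x\<rfloor>"] by simp
  also have "\<dots> = (\<Sum>n\<in>?A. card (?M n))"
  proof (rule card_UN_disjoint)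
    show "\<forall>a\<in>?A. \<forall>b\<in>?A. a \<noteq> b \<longrightarrow> ?M a \<inter> ?M b = {}"
    proof (intro ballI impI)
      fix a b assume ab: "a \<in> ?A" "b \<in> ?A" "a \<noteq> b"
      show "?M a \<inter> ?M b = {}"
      proof (rule ccontr)
        assume "?M a \<inter> ?M b \<noteq> {}"
        then obtain r s where "r \<in> cofactors \<theta> (x / real a) a" "s \<in> cofactors \<theta> (x / real b) b" "a * r = b * s"
          by blast
        then have "a = b" using ab
          by (intro \<B>_decomposition_unique[OF assms(1), of a b r s]) (auto simp: cofactors_def)
        then show False using ab by simp
      qed
    qed
  qed auto
  also have "\<dots> = (\<Sum>n\<in>?A. card (cofactors \<theta> (x / real n) n))"
    using pos by (intro sum.cong refl card_image inj_onI) auto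
  finally show ?thesis .
qed

text \<open>A cofactor other than 1 would have a prime factor at most u < \<theta>(n). Comparing in
  \<open>ereal\<close> includes the case \<theta>(n) = \<infinity>.\<close>

lemma cofactors_trivial:
  assumes "1 \<le> u" "ereal u < \<theta> n"
  shows "cofactors \<theta> u n = {1}"
proof (intro equalityI subsetI)
  fix r assume r: "r \<in> cofactors \<theta> u n"
  show "r \<in> {1}"
  proof (rule ccontr)
    assume "r \<notin> {1}"
    then obtain p where p: "prime p" "p dvd r" using prime_factor_nat by blast
    then have "\<theta> n < ereal (real p)" "p \<le> r" using r by (auto simp: cofactors_def intro: dvd_imp_le)
    then have "\<theta> n < ereal (real r)" by (meson ereal_less_eq(3) of_nat_mono order_less_le_trans)
    also have "\<dots> \<le> ereal u" using r by (simp add: cofactors_def)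
    finally show False using assms by simp
  qed
qed (use assms in \<open>auto simp: cofactors_def\<close>)

lemma cofactors_eq_rough_set:
  assumes "\<theta> n = ereal t" "0 \<le> t"
  shows "cofactors \<theta> u n = rough_set u (nat \<lfloor>t\<rfloor>)"
proof -
  have "t < real p \<longleftrightarrow> nat \<lfloor>t\<rfloor> < p" for p :: nat
    using assms(2) by linarith
  then show ?thesis unfolding cofactors_def rough_set_def assms(1) by simp
qed

lemma prime_prod_eq_mertens_prod:
  assumes "0 \<le> t"
  shows "prime_prod (ereal t) = mertens_prod (nat \<lfloor>t\<rfloor>)"
proof -
  have "{p. prime p \<and> ereal (real p) \<le> ereal t} = {p. prime p \<and> p \<le> nat \<lfloor>t\<rfloor>}"
    using assms by (auto simp: le_nat_floor) linarith
  then show ?thesis by (simp add: prime_prod_def mertens_prod_def)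
qed

section \<open>The asymptotic formula\<close>

text \<open>Dominated convergence for series: a finite F carries all but e/2 of the majorant, and
  the finitely many terms in F tend to 0.\<close>

lemma infsum_dominated_tendsto_0:
  fixes f :: "real \<Rightarrow> 'a \<Rightarrow> real"
  assumes g: "g summable_on A"
    and bound: "\<And>x n. x \<ge> x0 \<Longrightarrow> n \<in> A \<Longrightarrow> 0 \<le> f x n \<and> f x n \<le> g n"
    and lim: "\<And>n. n \<in> A \<Longrightarrow> ((\<lambda>x. f x n) \<longlongrightarrow> 0) at_top"
  shows "((\<lambda>x. \<Sum>\<^sub>\<infinity>n\<in>A. f x n) \<longlongrightarrow> 0) at_top"
proof (rule tendstoI)
  fix e :: real assume e: "0 < e"
  obtain F where F: "finite F" "F \<subseteq> A" "dist (sum g F) (infsum g A) \<le> e / 2"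
    using infsum_finite_approximation[OF g, of "e / 2"] e by auto
  have "((\<lambda>x. \<Sum>n\<in>F. f x n) \<longlongrightarrow> (\<Sum>n\<in>F. 0)) at_top"
    using lim F by (intro tendsto_sum) auto
  then have "eventually (\<lambda>x. (\<Sum>n\<in>F. f x n) < e / 2) at_top"
    using e by (intro order_tendstoD(2)[where y = 0]) auto
  then show "eventually (\<lambda>x. dist (\<Sum>\<^sub>\<infinity>n\<in>A. f x n) 0 < e) at_top"
    using eventually_ge_at_top[of x0]
  proof eventually_elim
    case (elim x)
    have fs: "f x summable_on A"
      using bound[OF elim(2)] by (intro summable_on_comparison_test[OF g]) auto
    have ds: "(\<lambda>n. g n - f x n) summable_on A"
      using bound[OF elim(2)] by (intro summable_on_comparison_test[OF g]) auto
    \<comment> \<open>Bounding the sum of g - f below by its part over F shows that the tail of f is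
      at most the tail of g.\<close>
    have "infsum (\<lambda>n. f x n + (g n - f x n)) A = infsum (f x) A + infsum (\<lambda>n. g n - f x n) A"
      using fs ds by (rule infsum_add)
    moreover have "(\<Sum>n\<in>F. g n - f x n) \<le> infsum (\<lambda>n. g n - f x n) A"
      using ds F bound[OF elim(2)] by (intro finite_sum_le_infsum) auto
    ultimately have "infsum (f x) A \<le> infsum g A - sum g F + sum (f x) F"
      by (simp add: sum_subtractf)
    moreover have "0 \<le> infsum (f x) A"
      using bound[OF elim(2)] by (intro infsum_nonneg) auto
    ultimately show ?case using F(3) elim(1) unfolding dist_real_def by linarith
  qed
qed

section \<open>Convergence of the series for L\<close>

lemma admissible_cases:
  assumes "admissible \<theta>" "0 < n"
  obtains "\<theta> n = \<infinity>" | t where "\<theta> n = ereal t" "2 \<le> t"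
  using admissible_ge_2[OF assms] that by (cases "\<theta> n") (auto simp: numeral_eq_ereal)

text \<open>Relates a real threshold t to the natural sieve level q, its floor: t <= q + 1 <= q^2
  for q >= 2, so the logarithms differ by a factor of at most 2.\<close>

lemma floor_bounds:
  assumes "2 \<le> (t::real)"
  shows "2 \<le> nat \<lfloor>t\<rfloor>" "real (nat \<lfloor>t\<rfloor>) \<le> t" "ln (real (nat \<lfloor>t\<rfloor>)) \<le> ln t"
    "ln t \<le> 2 * ln (real (nat \<lfloor>t\<rfloor>))"
proof -
  define q where "q = nat \<lfloor>t\<rfloor>"
  have q: "2 \<le> q" "real q \<le> t" "t \<le> real q + 1" using assms unfolding q_def by linarith+
  have "2 * real q \<le> real q * real q" using q by (intro mult_right_mono) auto
  moreover have "2 \<le> real q" using q by simp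
  ultimately have "t \<le> real q ^ 2" using q(3) unfolding power2_eq_square by linarith
  then have "ln t \<le> ln (real q ^ 2)" using assms by (intro ln_mono) auto
  then show "2 \<le> nat \<lfloor>t\<rfloor>" "real (nat \<lfloor>t\<rfloor>) \<le> t" "ln (real (nat \<lfloor>t\<rfloor>)) \<le> ln t"
    "ln t \<le> 2 * ln (real (nat \<lfloor>t\<rfloor>))"
    using q by (simp_all add: q_def[symmetric] ln_realpow)
qed

lemma L_term_not_in_\<B>: "n \<notin> \<B> \<theta> \<Longrightarrow> L_term \<theta> n = 0"
  by (simp add: L_term_def char_B_def)

lemma L_term_infinity: "\<theta> n = \<infinity> \<Longrightarrow> L_term \<theta> n = 0"
  by (simp add: L_term_def prime_prod_def)

lemma L_term_finite:
  "n \<in> \<B> \<theta> \<Longrightarrow> \<theta> n = ereal t \<Longrightarrow> 0 \<le> t \<Longrightarrow> L_term \<theta> n = mertens_prod (nat \<lfloor>t\<rfloor>) / real n"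
  by (simp add: L_term_def char_B_def prime_prod_eq_mertens_prod)

lemma L_term_nonneg:
  assumes "admissible \<theta>" "0 < n"
  shows "0 \<le> L_term \<theta> n"
proof (cases "n \<in> \<B> \<theta>")
  case True
  from assms show ?thesis
  proof (cases rule: admissible_cases)
    case (2 t)
    then show ?thesis using True mertens_prod_pos[of "nat \<lfloor>t\<rfloor>"] by (simp add: L_term_finite)
  qed (simp add: L_term_infinity)
qed (simp add: L_term_not_in_\<B>)

text \<open>The crude sieve bound suffices here because the subtracted term does not depend on
  x.\<close>

lemma card_cofactors_ge:
  assumes "admissible \<theta>" "n \<in> \<B> \<theta>" "0 \<le> x"
  shows "x * L_term \<theta> n - 2 ^ nat \<lfloor>real_of_ereal (\<theta> n)\<rfloor> \<le> real (card (cofactors \<theta> (x / real n) n))"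
proof -
  have n: "0 < n" using assms by (simp add: in_\<B>_iff)
  from assms(1) n show ?thesis
  proof (cases rule: admissible_cases)
    case (2 t)
    have "\<bar>rough_error (x / real n) (nat \<lfloor>t\<rfloor>)\<bar> \<le> 2 ^ nat \<lfloor>t\<rfloor>"
      using assms n by (intro rough_error_le_power) simp
    then show ?thesis
      using 2 assms by (simp add: rough_error_def cofactors_eq_rough_set L_term_finite)
  qed (simp add: L_term_infinity)
qed

text \<open>If a finite partial sum S exceeded 1, counting decomposed integers would give x S - D <=
  x with D independent of x, which fails for large x.\<close>

lemma sum_L_term_le_1:
  assumes "admissible \<theta>" "finite F" "F \<subseteq> {1..}"
  shows "sum (L_term \<theta>) F \<le> 1"
proof (rule ccontr)
  assume "\<not> sum (L_term \<theta>) F \<le> 1"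
  define S where "S = sum (L_term \<theta>) F"
  have S: "1 < S" using \<open>\<not> _\<close> by (simp add: S_def)
  define D where "D = (\<Sum>n\<in>F \<inter> \<B> \<theta>. (2::real) ^ nat \<lfloor>real_of_ereal (\<theta> n)\<rfloor>)"
  \<comment> \<open>Large enough to reach every element of F and to make x (S - 1) > D.\<close>
  define x where "x = max (real (Max (insert 0 F))) (D / (S - 1) + 1)"
  have D: "0 \<le> D" unfolding D_def by (intro sum_nonneg) simp
  have x0: "0 \<le> x" by (simp add: x_def max.coboundedI1)
  have Fx: "real n \<le> x" if "n \<in> F" for n
    using that assms(2) by (simp add: x_def max.coboundedI1)
  have "x * S - D = (\<Sum>n\<in>F \<inter> \<B> \<theta>. x * L_term \<theta> n - 2 ^ nat \<lfloor>real_of_ereal (\<theta> n)\<rfloor>)"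
  proof -
    have "S = sum (L_term \<theta>) (F \<inter> \<B> \<theta>)"
      unfolding S_def using assms by (intro sum.mono_neutral_right) (auto simp: L_term_not_in_\<B>)
    then show ?thesis by (simp add: D_def sum_subtractf sum_distrib_left)
  qed
  also have "\<dots> \<le> (\<Sum>n\<in>F \<inter> \<B> \<theta>. real (card (cofactors \<theta> (x / real n) n)))"
    using assms x0 by (intro sum_mono card_cofactors_ge) auto
  also have "\<dots> \<le> (\<Sum>n | real n \<le> x \<and> n \<in> \<B> \<theta>. real (card (cofactors \<theta> (x / real n) n)))"
    using Fx by (intro sum_mono2) auto
  also have "\<dots> = real (nat \<lfloor>x\<rfloor>)"
    unfolding floor_eq_sum_card_cofactors[OF assms(1) x0] by simp
  also have "\<dots> \<le> x" using x0 by simp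
  finally have "x * (S - 1) \<le> D" by (simp add: algebra_simps)
  moreover have "(D / (S - 1) + 1) * (S - 1) \<le> x * (S - 1)"
    using S by (intro mult_right_mono) (auto simp: x_def)
  moreover have "(D / (S - 1) + 1) * (S - 1) = D + (S - 1)" using S by (simp add: field_simps)
  ultimately show False using S by linarith
qed

lemma L_term_summable:
  assumes "admissible \<theta>"
  shows "L_term \<theta> summable_on {1..}"
proof (rule nonneg_bdd_above_summable_on)
  show "bdd_above (sum (L_term \<theta>) ` {F. F \<subseteq> {1..} \<and> finite F})"
    using sum_L_term_le_1[OF assms] by (intro bdd_aboveI[of _ 1]) auto
qed (use L_term_nonneg[OF assms] in auto)

section \<open>Majorant and pointwise decay of the error terms\<close>

lemma error_term_infinity: "\<theta> n = \<infinity> \<Longrightarrow> error_term \<theta> x n = 0"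
  by (simp add: error_term_def)

lemma error_term_finite:
  assumes "\<theta> n = ereal t" "n \<in> \<B> \<theta>"
  shows "error_term \<theta> x n =
    1 / (real n * ln t) * exp (- (max 0 (ln (x / real n)) / (3 * ln t)))"
  using assms by (simp add: error_term_def char_B_def)

lemma error_term_not_in_\<B>: "n \<notin> \<B> \<theta> \<Longrightarrow> error_term \<theta> x n = 0"
  by (simp add: error_term_def char_B_def)

text \<open>The exponential is at most 1, and the lower Mertens bound compares 1 / ln \<theta>(n)
  with the prime product. The majorant is independent of x.\<close>

lemma error_term_bounds:
  assumes "admissible \<theta>" "0 < n" and c: "0 < c" "\<And>y. 2 \<le> y \<Longrightarrow> c / ln (real y) \<le> mertens_prod y"
  shows "0 \<le> error_term \<theta> x n \<and> error_term \<theta> x n \<le> 1 / c * L_term \<theta> n"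
proof (cases "n \<in> \<B> \<theta>")
  case True
  from assms(1,2) show ?thesis
  proof (cases rule: admissible_cases)
    case (2 t)
    define q where "q = nat \<lfloor>t\<rfloor>"
    note q = floor_bounds[OF 2(2), folded q_def]
    have lt: "1 / 2 \<le> ln t" using 2 by (intro ln_ge_half)
    have lq: "1 / 2 \<le> ln (real q)" using q by (intro ln_ge_half) simp
    have "error_term \<theta> x n \<le> 1 / (real n * ln t) * 1"
      unfolding error_term_finite[of \<theta> n t, OF 2(1) True] using assms(2) lt
      by (intro mult_left_mono) auto
    also have "\<dots> \<le> 1 / (real n * ln (real q))"
      using assms(2) q lt lq by (auto intro!: divide_left_mono mult_left_mono mult_pos_pos)
    also have "\<dots> = 1 / c * (c / ln (real q) / real n)"
      using c by simp
    also have "\<dots> \<le> 1 / c * (mertens_prod q / real n)"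
      using c q by (intro mult_left_mono divide_right_mono) auto
    also have "\<dots> = 1 / c * L_term \<theta> n"
      using 2 True by (simp add: L_term_finite q_def)
    finally show ?thesis using lt unfolding error_term_finite[of \<theta> n t, OF 2(1) True] by simp
  qed (simp add: L_term_infinity error_term_infinity)
qed (simp add: L_term_not_in_\<B> error_term_not_in_\<B>)

lemma error_term_tendsto_0:
  assumes "admissible \<theta>" "0 < n"
  shows "((\<lambda>x. error_term \<theta> x n) \<longlongrightarrow> 0) at_top"
proof (cases "n \<in> \<B> \<theta>")
  case True
  from assms show ?thesis
  proof (cases rule: admissible_cases)
    case (2 t)
    have lt: "0 < 3 * ln t" using 2 by simp
    have "filterlim (\<lambda>x. x * (1 / real n)) at_top at_top"
      using assms(2) by (subst mult.commute,
        intro filterlim_tendsto_pos_mult_at_top[OF tendsto_const _ filterlim_ident]) auto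
    then have "filterlim (\<lambda>x. ln (x * (1 / real n))) at_top at_top"
      by (rule filterlim_compose[OF ln_at_top])
    then have "filterlim (\<lambda>x. max 0 (ln (x / real n))) at_top at_top"
      by (rule filterlim_at_top_mono) auto
    then have "filterlim (\<lambda>x. 1 / (3 * ln t) * max 0 (ln (x / real n))) at_top at_top"
      using lt by (intro filterlim_tendsto_pos_mult_at_top[OF tendsto_const]) auto
    then have "filterlim (\<lambda>x. - (max 0 (ln (x / real n)) / (3 * ln t))) at_bot at_top"
      by (simp add: filterlim_uminus_at_top)
    then have "((\<lambda>x. exp (- (max 0 (ln (x / real n)) / (3 * ln t)))) \<longlongrightarrow> 0) at_top"
      by (rule filterlim_compose[OF exp_at_bot])
    then show ?thesis
      unfolding error_term_finite[of \<theta> n t, OF 2(1) True]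
      by (rule tendsto_mult_right_zero)
  qed (simp add: error_term_infinity)
qed (simp add: error_term_not_in_\<B>)

section \<open>Counting the integers up to x with a cofactor other than 1\<close>

definition sieved_count :: "(nat \<Rightarrow> ereal) \<Rightarrow> real \<Rightarrow> nat \<Rightarrow> real" where
  "sieved_count \<theta> x n =
     (if real n \<le> x \<and> n \<in> \<B> \<theta> then real (card (cofactors \<theta> (x / real n) n)) - 1 else 0)"

lemma exp_minus_third_ge: "1 / 3 \<le> exp (- (1 / 3) :: real)"
proof -
  have "exp (1 / 3) \<le> exp (1::real)" by simp
  then have "exp (1 / 3) \<le> (3::real)" using exp_le by linarith
  then show ?thesis by (simp add: exp_minus field_simps)
qed

text \<open>Times ln t, the bound is u^(1 - 1/(3 ln t)), which increases with u; at u = t it is t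
  exp (-1/3) >= t/3 >= ln t / 3. This absorbs the trivial cofactor 1.\<close>

lemma one_le_sieve_bound:
  assumes "2 \<le> t" "t \<le> u"
  shows "1 \<le> 3 * sieve_bound u t"
proof -
  have lt: "1 / 2 \<le> ln t" using assms by (intro ln_ge_half)
  have e: "0 \<le> 1 - 1 / (3 * ln t)" using lt by (simp add: field_simps)
  have "ln t - 1 / 3 = ln t * (1 - 1 / (3 * ln t))" using lt by (simp add: field_simps)
  also have "\<dots> \<le> ln u * (1 - 1 / (3 * ln t))" using assms e by (intro mult_right_mono) auto
  finally have "exp (ln t - 1 / 3) \<le> exp (ln u * (1 - 1 / (3 * ln t)))" by simp
  moreover have "exp (ln t - 1 / 3) = t * exp (- (1 / 3))"
    using assms unfolding diff_conv_add_uminus exp_add by simp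
  moreover have "exp (ln u * (1 - 1 / (3 * ln t))) = u * exp (- (ln u / (3 * ln t)))"
  proof -
    have "ln u * (1 - 1 / (3 * ln t)) = ln u + - (ln u / (3 * ln t))"
      by (simp add: right_diff_distrib)
    then show ?thesis using assms by (simp only: exp_add) simp
  qed
  moreover have "t * (1 / 3) \<le> t * exp (- (1 / 3))"
    using assms exp_minus_third_ge by (intro mult_left_mono) auto
  moreover have "ln t \<le> t" using assms ln_le_minus_one[of t] by simp
  ultimately have "ln t \<le> 3 * (u * exp (- (ln u / (3 * ln t))))" by linarith
  then show ?thesis using lt by (simp add: sieve_bound_def field_simps)
qed

text \<open>For u = x/n below \<theta>(n) there are no nontrivial cofactors; the main term is at
  most 2u / ln \<theta>(n), and the exponential is at least 1/3, whence the 6. For u >= \<theta>(n)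
  the fundamental lemma applies.\<close>

lemma L_term_minus_sieved_count_le:
  assumes adm: "admissible \<theta>" and n: "0 < n" and x: "1 \<le> x" and C: "0 < C"
    "\<And>u y. 2 \<le> y \<Longrightarrow> real y \<le> u \<Longrightarrow> \<bar>rough_error u y\<bar> \<le> C * sieve_bound u (real y)"
  shows "\<bar>x * L_term \<theta> n - sieved_count \<theta> x n\<bar> \<le> (6 + 2 * C) * (x * error_term \<theta> x n)"
proof (cases "n \<in> \<B> \<theta>")
  case True
  define u where "u = x / real n"
  have u0: "0 < u" using n x by (simp add: u_def)
  have nx: "real n \<le> x \<longleftrightarrow> 1 \<le> u" using n by (simp add: u_def)
  from adm n show ?thesis
  proof (cases rule: admissible_cases)
    case 1
    then have "sieved_count \<theta> x n = 0"
      using nx cofactors_trivial[of u \<theta> n] by (auto simp: sieved_count_def u_def)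
    then show ?thesis using 1 by (simp add: L_term_infinity error_term_infinity)
  next
    case (2 t)
    define q where "q = nat \<lfloor>t\<rfloor>"
    note q = floor_bounds[OF 2(2), folded q_def]
    have lt: "1 / 2 \<le> ln t" using 2 by (intro ln_ge_half)
    have lq: "1 / 2 \<le> ln (real q)" using q by (intro ln_ge_half) simp
    have inv: "1 / ln (real q) \<le> 2 / ln t"
      using q(4) lt lq by (simp add: divide_le_eq pos_le_divide_eq)
    have L: "x * L_term \<theta> n = u * mertens_prod q"
      using 2 True by (simp add: L_term_finite q_def u_def)
    have err: "x * error_term \<theta> x n = u / ln t * exp (- (max 0 (ln u) / (3 * ln t)))"
      unfolding error_term_finite[of \<theta> n t, OF 2(1) True] u_def by simp
    show ?thesis
    proof (cases "u < t")
      case True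
      then have "sieved_count \<theta> x n = 0"
        using nx cofactors_trivial[of u \<theta> n] 2 by (auto simp: sieved_count_def u_def)
      then have "\<bar>x * L_term \<theta> n - sieved_count \<theta> x n\<bar> = u * mertens_prod q"
        using L u0 mertens_prod_pos[of q] by simp
      also have "\<dots> \<le> u * (2 / ln t)"
        using u0 q inv mertens_prod_le[of q] by (intro mult_left_mono) auto
      also have "\<dots> = 6 * (u / ln t * (1 / 3))" by simp
      also have "\<dots> \<le> 6 * (u / ln t * exp (- (max 0 (ln u) / (3 * ln t))))"
      proof (intro mult_left_mono)
        have "max 0 (ln u) \<le> ln t" using True u0 2 lt by simp
        then have "max 0 (ln u) / (3 * ln t) \<le> 1 / 3" using lt by (simp add: divide_le_eq)
        then have "exp (- (1 / 3)) \<le> exp (- (max 0 (ln u) / (3 * ln t)))" by simp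
        then show "1 / 3 \<le> exp (- (max 0 (ln u) / (3 * ln t)))"
          using exp_minus_third_ge by linarith
      qed (use u0 lt in auto)
      also have "\<dots> \<le> (6 + 2 * C) * (u / ln t * exp (- (max 0 (ln u) / (3 * ln t))))"
        using u0 lt C by (intro mult_right_mono) auto
      finally show ?thesis unfolding err .
    next
      case False
      then have ut: "t \<le> u" by simp
      then have u1: "1 \<le> u" using 2 by simp
      have sb0: "0 \<le> sieve_bound u t" using u1 2 by (intro sieve_bound_nonneg) auto
      \<comment> \<open>The level q <= t makes the exponential smaller, and 1 / ln q <= 2 / ln t
        costs the factor 2.\<close>
      have qt: "sieve_bound u (real q) \<le> 2 * sieve_bound u t"
      proof -
        have "ln u / (3 * ln t) \<le> ln u / (3 * ln (real q))"
          using u1 lt lq q(3) by (intro divide_left_mono) auto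
        then have "u * (1 / ln (real q)) * exp (- (ln u / (3 * ln (real q)))) \<le>
            u * (2 / ln t) * exp (- (ln u / (3 * ln t)))"
          using u0 inv lt by (intro mult_mono mult_left_mono) auto
        then show ?thesis by (simp add: sieve_bound_def mult_ac)
      qed
      have "x * L_term \<theta> n - sieved_count \<theta> x n = 1 - rough_error u q"
        unfolding L using True u1 nx 2 cofactors_eq_rough_set[of \<theta> n t u]
        by (simp add: sieved_count_def rough_error_def q_def u_def)
      then have "\<bar>x * L_term \<theta> n - sieved_count \<theta> x n\<bar> \<le> 1 + \<bar>rough_error u q\<bar>" by simp
      also have "\<dots> \<le> 3 * sieve_bound u t + C * sieve_bound u (real q)"
        using 2 ut q by (intro add_mono one_le_sieve_bound C(2)) auto
      also have "\<dots> \<le> 3 * sieve_bound u t + C * (2 * sieve_bound u t)"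
        using qt C by (intro add_left_mono mult_left_mono) auto
      also have "\<dots> \<le> (6 + 2 * C) * sieve_bound u t"
        using sb0 by (simp add: algebra_simps)
      \<comment> \<open>As u >= 1, the \<open>max 0\<close> in the error term has no effect, and the
        3 in the exponents agrees.\<close>
      also have "sieve_bound u t = x * error_term \<theta> x n"
        using u1 by (simp add: err sieve_bound_def)
      finally show ?thesis .
    qed
  qed
qed (simp add: L_term_not_in_\<B> error_term_not_in_\<B> sieved_count_def)

lemma sieved_count_has_sum:
  assumes "admissible \<theta>" "0 \<le> x"
  shows "(sieved_count \<theta> x has_sum (real (nat \<lfloor>x\<rfloor>) - real (B \<theta> x))) {1..}"
proof -
  let ?A = "{n. real n \<le> x \<and> n \<in> \<B> \<theta>}"
  have "sum (sieved_count \<theta> x) ?A = (\<Sum>n\<in>?A. real (card (cofactors \<theta> (x / real n) n))) - real (card ?A)"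
    by (simp add: sieved_count_def sum_subtractf)
  also have "\<dots> = real (nat \<lfloor>x\<rfloor>) - real (B \<theta> x)"
    unfolding floor_eq_sum_card_cofactors[OF assms] B_def by simp
  finally have "(sieved_count \<theta> x has_sum (real (nat \<lfloor>x\<rfloor>) - real (B \<theta> x))) ?A"
    by (intro has_sum_finiteI) auto
  then show ?thesis
    by (rule has_sum_cong_neutral[THEN iffD1, rotated -1]) (auto simp: sieved_count_def in_\<B>_iff)
qed

text \<open>Summing the termwise differences gives B(x) - (1 - L)x up to the rounding of x, which is
  at most 1. The constant is fixed before \<theta> is chosen, so it is uniform in \<theta>.\<close>

lemma B_error_bound:
  obtains C where "0 < C" "\<And>\<theta> x. admissible \<theta> \<Longrightarrow> 1 \<le> x \<Longrightarrow> error_term \<theta> x summable_on {1..} \<Longrightarrow>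
    \<bar>real (B \<theta> x) - (1 - L \<theta>) * x\<bar> \<le> C * (1 + x * (\<Sum>\<^sub>\<infinity>n\<in>{1..}. error_term \<theta> x n))"
proof -
  obtain C where C: "0 < C"
    "\<And>u y. 2 \<le> y \<Longrightarrow> real y \<le> u \<Longrightarrow> \<bar>rough_error u y\<bar> \<le> C * sieve_bound u (real y)"
    using fundamental_lemma by blast
  show ?thesis
  proof
    show "0 < 6 + 2 * C" using C by simp
    fix \<theta> and x :: real
    assume adm: "admissible \<theta>" and x: "1 \<le> x" and es: "error_term \<theta> x summable_on {1..}"
    let ?d = "\<lambda>n. x * L_term \<theta> n - sieved_count \<theta> x n"
    have bound: "norm (?d n) \<le> (6 + 2 * C) * x * error_term \<theta> x n" if "n \<in> {1..}" for n
      using L_term_minus_sieved_count_le[OF adm _ x C, of n] that by (simp add: mult.assoc)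
    have Ls: "(L_term \<theta> has_sum L \<theta>) {1..}"
      unfolding L_def using L_term_summable[OF adm] by (rule has_sum_infsum)
    have "((\<lambda>n. x * L_term \<theta> n + (-1) * sieved_count \<theta> x n) has_sum
        (x * L \<theta> + (-1) * (real (nat \<lfloor>x\<rfloor>) - real (B \<theta> x)))) {1..}"
      using adm x by (intro has_sum_add has_sum_cmult_right Ls sieved_count_has_sum) auto
    then have "(?d has_sum (x * L \<theta> - (real (nat \<lfloor>x\<rfloor>) - real (B \<theta> x)))) {1..}"
      by (simp add: algebra_simps)
    then have d: "infsum ?d {1..} = x * L \<theta> - (real (nat \<lfloor>x\<rfloor>) - real (B \<theta> x))"
      by (rule infsumI)
    have rs: "(\<lambda>n. (6 + 2 * C) * x * error_term \<theta> x n) summable_on {1..}"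
      using es by (rule summable_on_cmult_right)
    have ds: "(\<lambda>n. norm (?d n)) summable_on {1..}"
      by (intro summable_on_comparison_test[OF rs] bound norm_ge_zero)
    have "\<bar>infsum ?d {1..}\<bar> \<le> infsum (\<lambda>n. norm (?d n)) {1..}"
      using norm_infsum_bound[OF ds] by simp
    also have "\<dots> \<le> infsum (\<lambda>n. (6 + 2 * C) * x * error_term \<theta> x n) {1..}"
      using ds rs bound by (intro infsum_mono)
    also have "\<dots> = (6 + 2 * C) * (x * (\<Sum>\<^sub>\<infinity>n\<in>{1..}. error_term \<theta> x n))"
      by (simp add: infsum_cmult_right' mult.assoc)
    finally have main: "\<bar>infsum ?d {1..}\<bar> \<le> (6 + 2 * C) * (x * (\<Sum>\<^sub>\<infinity>n\<in>{1..}. error_term \<theta> x n))" .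
    have "real (B \<theta> x) - (1 - L \<theta>) * x = infsum ?d {1..} + (real (nat \<lfloor>x\<rfloor>) - x)"
      unfolding d by (simp add: algebra_simps)
    moreover have "\<bar>real (nat \<lfloor>x\<rfloor>) - x\<bar> \<le> 1" using x by linarith
    ultimately have "\<bar>real (B \<theta> x) - (1 - L \<theta>) * x\<bar> \<le>
        1 + (6 + 2 * C) * (x * (\<Sum>\<^sub>\<infinity>n\<in>{1..}. error_term \<theta> x n))"
      using main by linarith
    then show "\<bar>real (B \<theta> x) - (1 - L \<theta>) * x\<bar> \<le>
        (6 + 2 * C) * (1 + x * (\<Sum>\<^sub>\<infinity>n\<in>{1..}. error_term \<theta> x n))"
      using C by (simp add: distrib_left)
  qed
qed

theorem theorem2p1:
  shows "(\<forall>\<theta>. admissible \<theta> \<longrightarrow>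
            L_term \<theta> summable_on {1..} \<and>
            (\<lambda>x::real. real (B \<theta> x) - (1 - L \<theta>) * x) \<in> o[at_top](\<lambda>x. x)) \<and>
         (\<exists>C::real. \<forall>\<theta>. admissible \<theta> \<longrightarrow>
            (\<forall>x::real. x \<ge> 1 \<longrightarrow>
               error_term \<theta> x summable_on {1..} \<and>
               \<bar>real (B \<theta> x) - (1 - L \<theta>) * x\<bar>
                 \<le> C * (1 + x * (\<Sum>\<^sub>\<infinity>n\<in>{1..}. error_term \<theta> x n))))"
proof -
  obtain c where c: "0 < c" "\<And>y. 2 \<le> y \<Longrightarrow> c / ln (real y) \<le> mertens_prod y"
    using mertens_prod_ge by blast
  obtain C where C: "0 < C" "\<And>\<theta> x. admissible \<theta> \<Longrightarrow> 1 \<le> x \<Longrightarrow> error_term \<theta> x summable_on {1..} \<Longrightarrow>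
    \<bar>real (B \<theta> x) - (1 - L \<theta>) * x\<bar> \<le> C * (1 + x * (\<Sum>\<^sub>\<infinity>n\<in>{1..}. error_term \<theta> x n))"
    using B_error_bound by blast
  have bounds: "0 \<le> error_term \<theta> x n \<and> error_term \<theta> x n \<le> 1 / c * L_term \<theta> n"
    if "admissible \<theta>" "n \<in> {1..}" for \<theta> x n
    using that c by (intro error_term_bounds) auto
  \<comment> \<open>One majorant for all x: it yields both the summability of the error series and
    the domination needed for its limit.\<close>
  have maj: "(\<lambda>n. 1 / c * L_term \<theta> n) summable_on {1..}" if "admissible \<theta>" for \<theta>
    using L_term_summable[OF that] by (rule summable_on_cmult_right)
  have es: "error_term \<theta> x summable_on {1..}" if "admissible \<theta>" for \<theta> x
    using bounds[OF that] by (intro summable_on_comparison_test[OF maj[OF that]]) auto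
  \<comment> \<open>Dividing the explicit estimate by x leaves C (1/x + S(x)), and the error series
    S(x) tends to 0 by dominated convergence.\<close>
  have small: "(\<lambda>x::real. real (B \<theta> x) - (1 - L \<theta>) * x) \<in> o[at_top](\<lambda>x. x)"
    if adm: "admissible \<theta>" for \<theta>
  proof (rule smalloI_tendsto)
    define S where "S x = (\<Sum>\<^sub>\<infinity>n\<in>{1..}. error_term \<theta> x n)" for x
    have S: "(S \<longlongrightarrow> 0) at_top"
      unfolding S_def
      using bounds[OF adm] error_term_tendsto_0[OF adm]
      by (intro infsum_dominated_tendsto_0[OF maj[OF adm]]) auto
    have inv: "((\<lambda>x::real. 1 / x) \<longlongrightarrow> 0) at_top"
      using tendsto_inverse_0_at_top[OF filterlim_ident] by (simp add: inverse_eq_divide)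
    have lim: "((\<lambda>x. C * (1 / x + S x)) \<longlongrightarrow> 0) at_top"
      using tendsto_mult_right_zero[OF tendsto_add_zero[OF inv S]] .
    show "((\<lambda>x. (real (B \<theta> x) - (1 - L \<theta>) * x) / x) \<longlongrightarrow> 0) at_top"
    proof (rule Lim_null_comparison[OF _ lim])
      show "\<forall>\<^sub>F x in at_top. norm ((real (B \<theta> x) - (1 - L \<theta>) * x) / x) \<le> C * (1 / x + S x)"
        using eventually_ge_at_top[of 1]
      proof eventually_elim
        case (elim x)
        have "norm ((real (B \<theta> x) - (1 - L \<theta>) * x) / x) = \<bar>real (B \<theta> x) - (1 - L \<theta>) * x\<bar> / x"
          using elim by (simp add: abs_divide)
        also have "\<dots> \<le> C * (1 + x * S x) / x"
          using C(2)[OF adm elim es[OF adm]] elim unfolding S_def by (intro divide_right_mono) auto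
        also have "\<dots> = C * (1 / x + S x)" using elim by (simp add: field_simps)
        finally show ?case .
      qed
    qed
    show "\<forall>\<^sub>F x in at_top. x \<noteq> (0::real)"
      using eventually_gt_at_top[of 0] by eventually_elim simp
  qed
  show ?thesis
    using L_term_summable small es C(2) by blast
qed

end
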